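(* Let $\varphi\in L^1(\mathbb{R})$, let $N,M$ be nonnegative integers, let $\delta_0:=1$ and let $\delta_k\in\{0,1\}$ for $k\in\mathbb{N}=\{1,2,\dots\}$. Assume that for all $n\in\mathbb{Z}$, $$\int_{\mathbb{R}}\varphi(t)\,\frac{e^{i\pi nt}-\sum_{k=0}^{N-1}\frac{1}{k!}(i\pi nt)^k}{(it)^{N-1+\delta_N}}\,dt=0$$ and $$\int_{\mathbb{R}}\varphi(t)\left(e^{i\pi n/t}-\sum_{k=0}^{M-1}\frac{1}{k!}\left(\frac{i\pi n}{t}\right)^k\right)\left(\frac{t}{i}\right)^{M-1+\delta_M}dt=0,$$ where $\sum_{k=0}^{-1}:=0$. Then $\varphi=0$.
   Context: The equality $\varphi=0$ is in $L^1(\mathbb{R})$, i.e. almost everywhere with respect to Lebesgue measure. *)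

theory Defs
  imports "HOL-Analysis.Analysis"
begin

end

theory Submission
  imports Defs "HOL-Probability.Characteristic_Functions"
begin

text \<open>
  Write \<open>\<psi> s = \<phi> (1 / s) / s\<^sup>2\<close>. The substitution \<open>t = 1 / s\<close> turns the second family of
  conditions on \<open>\<phi>\<close> into a family of the first kind for \<open>\<psi>\<close>, so both functions are treated alike.

  Taking \<open>N\<close>-th differences in \<open>n\<close> removes the Taylor polynomial from the test functions and leaves
  \<open>exp (\<i> \<pi> n t) (exp (\<i> \<pi> t) - 1)^N / (\<i> t)^m\<close>, where \<open>m\<close> is \<open>N\<close> or \<open>N - 1\<close>. Uniqueness of Fourier
  coefficients on \<open>(-1, 1)\<close> then shows that the 2-periodization of \<open>\<phi> t / t^m\<close> vanishes. Isolating the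
  term of the fundamental interval, where the factor \<open>\<bar>t\<bar>^m / \<bar>t + 2j\<bar>^m\<close> of the other terms is at most 1,
  gives \<open>\<bar>\<phi> t\<bar> \<le> (\<Sum>j\<noteq>0. \<bar>\<phi> (t + 2j)\<bar>)\<close>, whose right-hand side is \<open>transfer \<bar>\<psi>\<bar> t\<close> for the transfer
  operator of the map \<open>x \<mapsto> 1 / x\<close> modulo 2 on \<open>(-1, 1)\<close>: this is \<open>annihilator_le_transfer\<close>.
  By symmetry \<open>\<bar>\<psi>\<bar> \<le> transfer \<bar>\<phi>\<bar>\<close>, so \<open>h = \<bar>\<phi>\<bar> + \<bar>\<psi>\<bar>\<close> is an integrable function with
  \<open>h \<le> transfer h\<close> on \<open>(-1, 1)\<close>. If every such \<open>h\<close> is zero, then \<open>\<phi>\<close> vanishes inside \<open>(-1, 1)\<close>,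
  and outside it because \<open>\<psi>\<close> vanishes inside.

  That \<open>h = 0\<close> (\<open>subinvariant_density_eq_0\<close>) is a statement of infinite ergodic theory: the map has the
  infinite invariant density \<open>1 / (1 - x\<^sup>2)\<close>, because the fixed points at the ends of the interval are
  parabolic. The proof follows the densities \<open>q n = (transfer ^^ n) 1\<close> and uses two facts.
  First, the operator acts in the same way on both variables of the Bergman kernel
  \<open>1 / (1 - x y)\<^sup>2\<close>, so that \<open>q n x\<close> can be computed at the point 0; this yields the Harnack
  inequality \<open>q n 0 \<le> q n x \<le> q n 0 / (1 - \<bar>x\<bar>)\<^sup>2\<close>. Second, mass that is bounded below everywhere
  piles up at the parabolic points: the sum of the first \<open>2 N\<close> densities has total mass \<open>4 N\<close>, but it is at
  least a ninth of the value at 0 of the sum of the first \<open>N\<close> densities times a function whose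
  integral is the harmonic number \<open>harm N\<close>. Hence the averages of \<open>q n 0\<close> are \<open>O(1 / harm N)\<close> and, by
  Harnack, the averages of \<open>q n\<close> tend to zero locally uniformly. Since \<open>h\<close> is bounded up to a small
  integrable error and is dominated by each of its iterates, the integral of \<open>h\<close> over a compact set is
  arbitrarily small.
\<close>

section \<open>Inversion and tiling of the line\<close>

text \<open>As an identity of measures, the substitution \<open>t = 1 / s\<close> serves nonnegative integrals and
  complex ones (\<open>integral_reciprocal\<close> below) at the same time. The value \<open>1 / 0 = 0\<close> only affects a null set.\<close>
lemma lborel_eq_distr_reciprocal:
  "(lborel :: real measure) = distr (density lborel (\<lambda>s. ennreal (1 / s\<^sup>2))) borel (\<lambda>s. 1 / s)"
proof (rule lborel_eqI)
  fix l u :: real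
  assume "\<And>b. b \<in> Basis \<Longrightarrow> l \<bullet> b \<le> u \<bullet> b"
  then have le: "l \<le> u" by simp
  let ?f = "indicator {l<..<u} :: real \<Rightarrow> real"
  let ?g = "\<lambda>s. 1 / s\<^sup>2 * ?f (1 / s)"
  have img: "(\<lambda>s. 1 / s) ` (- {0}) = - {0::real}"
  proof (intro equalityI subsetI)
    fix x :: real assume "x \<in> - {0}"
    then show "x \<in> (\<lambda>s. 1 / s) ` (- {0})"
      by (intro image_eqI[of _ _ "1 / x"]) auto
  qed auto
  have *: "(\<lambda>s. \<bar>- (1 / s\<^sup>2)\<bar> * ?f (1 / s)) absolutely_integrable_on - {0} \<and>
        integral (- {0}) (\<lambda>s. \<bar>- (1 / s\<^sup>2)\<bar> * ?f (1 / s)) = u - l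
     \<longleftrightarrow> ?f absolutely_integrable_on ((\<lambda>s. 1 / s) ` (- {0})) \<and> integral ((\<lambda>s. 1 / s) ` (- {0})) ?f = u - l"
  proof (rule has_absolute_integral_change_of_variables_1')
    show "((\<lambda>s. 1 / s) has_real_derivative - (1 / x\<^sup>2)) (at x within - {0})" if "x \<in> - {0}" for x
      using that by (auto intro!: derivative_eq_intros simp: power2_eq_square)
    show "inj_on (\<lambda>s::real. 1 / s) (- {0})" by (auto simp: inj_on_def)
  qed auto
  have f: "(?f has_integral (u - l)) (- {0})"
  proof -
    have "((\<lambda>x. 1) has_integral (u - l)) {l<..<u}"
      using le has_integral_const_real[of "1::real" l u] by (simp add: has_integral_Icc_iff_Ioo)
    then have "(?f has_integral (u - l)) UNIV"
      by (subst (asm) has_integral_restrict_UNIV[symmetric]) (simp add: indicator_def[abs_def] of_bool_def)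
    then show ?thesis
      by (subst has_integral_spike_set_eq[of _ UNIV]) (auto intro: negligible_subset[of "{0}"])
  qed
  have "?f absolutely_integrable_on - {0}"
    using f by (intro nonnegative_absolutely_integrable_1) (auto simp: integrable_on_def)
  with f img * have g: "?g absolutely_integrable_on - {0} \<and> integral (- {0}) ?g = u - l"
    by (simp add: integral_unique)
  then have "(?g has_integral (u - l)) (- {0})"
    using integrable_integral set_lebesgue_integral_eq_integral(1) by metis
  then have "(?g has_integral (u - l)) UNIV"
    by (subst (asm) has_integral_spike_set_eq[of _ UNIV]) (auto intro: negligible_subset[of "{0}"])
  then have "integral\<^sup>N lborel (\<lambda>s. ennreal (?g s)) = ennreal (u - l)"
    by (intro nn_integral_has_integral_lborel) auto
  moreover have "emeasure (distr (density lborel (\<lambda>s. ennreal (1 / s\<^sup>2))) borel (\<lambda>s. 1 / s)) (box l u)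
      = integral\<^sup>N lborel (\<lambda>s. ennreal (?g s))"
  proof -
    have "emeasure (distr (density lborel (\<lambda>s. ennreal (1 / s\<^sup>2))) borel (\<lambda>s. 1 / s)) (box l u)
      = (\<integral>\<^sup>+x. indicator {l<..<u} x \<partial>distr (density lborel (\<lambda>s. ennreal (1 / s\<^sup>2))) borel (\<lambda>s. 1 / s))"
      by simp
    also have "\<dots> = (\<integral>\<^sup>+s. ennreal (1 / s\<^sup>2) * indicator {l<..<u} (1 / s) \<partial>lborel)"
      by (subst nn_integral_distr) (auto simp: nn_integral_density)
    also have "\<dots> = integral\<^sup>N lborel (\<lambda>s. ennreal (?g s))"
      by (intro nn_integral_cong) (auto split: split_indicator)
    finally show ?thesis .
  qed
  ultimately show "emeasure (distr (density lborel (\<lambda>s. ennreal (1 / s\<^sup>2))) borel (\<lambda>s. 1 / s)) (box l u)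
      = ennreal (\<Prod>b\<in>Basis. (u - l) \<bullet> b)"
    by simp
qed simp

lemma nn_integral_reciprocal:
  fixes f :: "real \<Rightarrow> ennreal"
  assumes [measurable]: "f \<in> borel_measurable borel"
  shows "(\<integral>\<^sup>+s. ennreal (1 / s\<^sup>2) * f (1 / s) \<partial>lborel) = (\<integral>\<^sup>+t. f t \<partial>lborel)"
  by (subst (2) lborel_eq_distr_reciprocal) (simp add: nn_integral_distr nn_integral_density)

text \<open>All dynamics takes place on the fundamental interval \<open>(-1, 1)\<close> of the translations by even integers.\<close>
abbreviation lborel_I :: "real measure" where
  "lborel_I \<equiv> restrict_space lborel {-1<..<1}"

lemma sigma_finite_count_space_int: "sigma_finite_measure (count_space (UNIV :: int set))"
  by (rule sigma_finite_measure_count_space)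

lemma disjoint_family_tiles: "disjoint_family (\<lambda>j. {2 * real_of_int j - 1 <..< 2 * real_of_int j + 1})"
proof (unfold disjoint_family_on_def, intro ballI impI)
  fix i j :: int assume "i \<noteq> j"
  then have "i + 1 \<le> j \<or> j + 1 \<le> i" by linarith
  then have "real_of_int i + 1 \<le> real_of_int j \<or> real_of_int j + 1 \<le> real_of_int i"
    by (metis of_int_1 of_int_add of_int_le_iff)
  then show "{2 * real_of_int i - 1 <..< 2 * real_of_int i + 1} \<inter> {2 * real_of_int j - 1 <..< 2 * real_of_int j + 1} = {}"
    by auto
qed

text \<open>The translates of \<open>(-1, 1)\<close> by even integers are disjoint and miss only the odd integers.\<close>
lemma nn_integral_tile:
  fixes F :: "real \<Rightarrow> ennreal"
  assumes [measurable]: "F \<in> borel_measurable borel"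
  shows "(\<integral>\<^sup>+t. (\<integral>\<^sup>+j. F (t + 2 * real_of_int j) \<partial>count_space UNIV) \<partial>lborel_I) = (\<integral>\<^sup>+t. F t \<partial>lborel)"
proof -
  let ?T = "\<lambda>j. {2 * real_of_int j - 1 <..< 2 * real_of_int j + 1}"
  have tile: "(\<integral>\<^sup>+t. F (t + 2 * real_of_int j) \<partial>lborel_I) = (\<integral>\<^sup>+t. F t * indicator (?T j) t \<partial>lborel)" for j
  proof -
    have "(\<integral>\<^sup>+t. F t * indicator (?T j) t \<partial>lborel)
       = (\<integral>\<^sup>+t. F (2 * real_of_int j + 1 * t) * indicator (?T j) (2 * real_of_int j + 1 * t) \<partial>lborel)"
      by (subst nn_integral_real_affine[of _ 1 "2 * real_of_int j"]) auto
    also have "\<dots> = (\<integral>\<^sup>+t. F (t + 2 * real_of_int j) * indicator {-1<..<1} t \<partial>lborel)"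
      by (intro nn_integral_cong) (auto split: split_indicator simp: add.commute)
    finally show ?thesis by (simp add: nn_integral_restrict_space)
  qed
  have cover: "(\<integral>\<^sup>+j. indicator (?T j) t \<partial>count_space UNIV) = (1::ennreal)"
    if "t \<notin> range (\<lambda>j. 2 * real_of_int j + 1)" for t
  proof -
    define j where "j = \<lfloor>(t + 1) / 2\<rfloor>"
    have "real_of_int j \<le> (t + 1) / 2" "(t + 1) / 2 < real_of_int j + 1"
      unfolding j_def by linarith+
    moreover have "t \<noteq> 2 * real_of_int (j - 1) + 1"
      using that by blast
    ultimately have t: "t \<in> ?T j" by auto
    have "indicator (?T i) t = (indicator {j} i :: ennreal)" for i
      using t disjoint_family_tiles by (fastforce simp: disjoint_family_on_def indicator_def)
    then show ?thesis by simp
  qed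
  have "(\<integral>\<^sup>+t. (\<integral>\<^sup>+j. F (t + 2 * real_of_int j) \<partial>count_space UNIV) \<partial>lborel_I)
     = (\<integral>\<^sup>+j. (\<integral>\<^sup>+t. F (t + 2 * real_of_int j) \<partial>lborel_I) \<partial>count_space UNIV)"
    by (intro nn_integral_count_space_nn_integral measurable_restrict_space1) auto
  also have "\<dots> = (\<integral>\<^sup>+j. (\<integral>\<^sup>+t. F t * indicator (?T j) t \<partial>lborel) \<partial>count_space UNIV)"
    by (simp add: tile)
  also have "\<dots> = (\<integral>\<^sup>+t. (\<integral>\<^sup>+j. F t * indicator (?T j) t \<partial>count_space UNIV) \<partial>lborel)"
    by (rule nn_integral_count_space_nn_integral[symmetric]) auto
  also have "\<dots> = (\<integral>\<^sup>+t. F t \<partial>lborel)"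
  proof (rule nn_integral_cong_AE)
    have "AE t in lborel. t \<notin> range (\<lambda>j. 2 * real_of_int j + 1)"
      by (intro AE_not_in countable_imp_null_set_lborel) auto
    then show "AE t in lborel. (\<integral>\<^sup>+j. F t * indicator (?T j) t \<partial>count_space UNIV) = F t"
      by eventually_elim (simp add: nn_integral_cmult cover)
  qed
  finally show ?thesis .
qed

lemma measurable_tile_map:
  "(\<lambda>(t, j). t + 2 * real_of_int j) \<in> lborel_I \<Otimes>\<^sub>M count_space UNIV \<rightarrow>\<^sub>M borel"
proof -
  have [measurable]: "fst \<in> lborel_I \<Otimes>\<^sub>M count_space UNIV \<rightarrow>\<^sub>M (borel :: real measure)"
    by (rule measurable_compose[OF measurable_fst measurable_restrict_space1[OF measurable_ident_sets]]) simp
  have [measurable]: "(\<lambda>p. real_of_int (snd p)) \<in> lborel_I \<Otimes>\<^sub>M count_space UNIV \<rightarrow>\<^sub>M borel"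
    by (rule measurable_compose[OF measurable_snd]) simp
  show ?thesis
    unfolding case_prod_beta by measurable
qed

text \<open>In this form the tiling also applies to complex integrals, and Fubini's theorem on the product
  provides the almost everywhere absolute convergence of periodizations.\<close>
lemma lborel_eq_distr_tile:
  "(lborel :: real measure)
     = distr (lborel_I \<Otimes>\<^sub>M count_space UNIV) borel (\<lambda>(t, j). t + 2 * real_of_int j)"
proof (rule measure_eqI)
  interpret C: sigma_finite_measure "count_space (UNIV :: int set)" by (rule sigma_finite_count_space_int)
  fix A :: "real set" assume "A \<in> sets lborel"
  then have [measurable]: "A \<in> sets borel" by simp
  note [measurable] = measurable_tile_map
  have "emeasure (distr (lborel_I \<Otimes>\<^sub>M count_space UNIV) borel (\<lambda>(t, j). t + 2 * real_of_int j)) A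
    = (\<integral>\<^sup>+x. indicator A (case x of (t, j) \<Rightarrow> t + 2 * real_of_int j) \<partial>(lborel_I \<Otimes>\<^sub>M count_space UNIV))"
  proof -
    have "emeasure (distr (lborel_I \<Otimes>\<^sub>M count_space UNIV) borel (\<lambda>(t, j). t + 2 * real_of_int j)) A
      = (\<integral>\<^sup>+x. indicator A x \<partial>distr (lborel_I \<Otimes>\<^sub>M count_space UNIV) borel (\<lambda>(t, j). t + 2 * real_of_int j))"
      by simp
    also have "\<dots> = (\<integral>\<^sup>+x. indicator A (case x of (t, j) \<Rightarrow> t + 2 * real_of_int j) \<partial>(lborel_I \<Otimes>\<^sub>M count_space UNIV))"
      by (rule nn_integral_distr) measurable
    finally show ?thesis .
  qed
  also have "\<dots> = (\<integral>\<^sup>+t. (\<integral>\<^sup>+j. indicator A (t + 2 * real_of_int j) \<partial>count_space UNIV) \<partial>lborel_I)"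
    by (subst C.nn_integral_fst[symmetric]) auto
  also have "\<dots> = emeasure lborel A"
    by (subst nn_integral_tile) auto
  finally show "emeasure lborel A
     = emeasure (distr (lborel_I \<Otimes>\<^sub>M count_space UNIV) borel (\<lambda>(t, j). t + 2 * real_of_int j)) A" by simp
qed simp

section \<open>The transfer operator of inversion modulo 2\<close>

text \<open>This is the Perron--Frobenius operator of the map on \<open>(-1, 1)\<close> sending \<open>x\<close> to the representative of
  \<open>1 / x\<close> modulo 2: the inverse branches are \<open>x \<mapsto> 1 / (x + 2 j)\<close> with \<open>j \<noteq> 0\<close>, and the weights are the
  absolute values of their derivatives. Values in the extended nonnegative reals spare every convergence question.\<close>
definition transfer :: "(real \<Rightarrow> ennreal) \<Rightarrow> real \<Rightarrow> ennreal" where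
  "transfer f x = (\<integral>\<^sup>+j. ennreal (1 / (x + 2 * real_of_int j)\<^sup>2) * f (1 / (x + 2 * real_of_int j))
                      \<partial>count_space (- {0}))"

lemma branch_point:
  assumes "x \<in> {-1<..<1}" "j \<noteq> (0::int)"
  shows "\<bar>x + 2 * real_of_int j\<bar> > 1" "1 / (x + 2 * real_of_int j) \<in> {-1<..<1}"
proof -
  from \<open>j \<noteq> 0\<close> have "j \<le> -1 \<or> 1 \<le> j" by linarith
  then have "real_of_int j \<le> -1 \<or> 1 \<le> real_of_int j"
    by (metis of_int_1 of_int_le_iff of_int_minus)
  with assms(1) show *: "\<bar>x + 2 * real_of_int j\<bar> > 1" by auto
  then have "\<bar>1 / (x + 2 * real_of_int j)\<bar> < 1" by (simp add: divide_less_eq)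
  then show "1 / (x + 2 * real_of_int j) \<in> {-1<..<1}" by (simp only: greaterThanLessThan_iff) linarith
qed

lemma transfer_mono:
  assumes "x \<in> {-1<..<1}" "\<And>y. y \<in> {-1<..<1} \<Longrightarrow> f y \<le> g y"
  shows "transfer f x \<le> transfer g x"
  unfolding transfer_def using branch_point[OF assms(1)] assms(2)
  by (intro nn_integral_mono mult_left_mono) auto

lemma transfer_cong:
  assumes "x \<in> {-1<..<1}" "\<And>y. y \<in> {-1<..<1} \<Longrightarrow> f y = g y"
  shows "transfer f x = transfer g x"
  using assms by (intro antisym transfer_mono) auto

lemma transfer_nn_integral:
  assumes "countable I"
  shows "transfer (\<lambda>x. \<integral>\<^sup>+i. c i * f i x \<partial>count_space I) x = (\<integral>\<^sup>+i. c i * transfer (f i) x \<partial>count_space I)"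
proof -
  have "transfer (\<lambda>x. \<integral>\<^sup>+i. c i * f i x \<partial>count_space I) x
    = (\<integral>\<^sup>+j. \<integral>\<^sup>+i. ennreal (1 / (x + 2 * real_of_int j)\<^sup>2) * (c i * f i (1 / (x + 2 * real_of_int j)))
         \<partial>count_space I \<partial>count_space (- {0}))"
    unfolding transfer_def by (simp add: nn_integral_cmult)
  also have "\<dots> = (\<integral>\<^sup>+i. \<integral>\<^sup>+j. ennreal (1 / (x + 2 * real_of_int j)\<^sup>2) * (c i * f i (1 / (x + 2 * real_of_int j)))
         \<partial>count_space (- {0}) \<partial>count_space I)"
    using assms by (intro nn_integral_count_space_nn_integral) auto
  also have "\<dots> = (\<integral>\<^sup>+i. c i * transfer (f i) x \<partial>count_space I)"
    unfolding transfer_def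
    by (simp add: nn_integral_cmult[symmetric] mult.left_commute)
  finally show ?thesis .
qed

lemma transfer_add: "transfer (\<lambda>y. f y + g y) x = transfer f x + transfer g x"
  unfolding transfer_def by (simp add: distrib_left nn_integral_add)

lemma transfer_cmult: "transfer (\<lambda>y. c * f y) x = c * transfer f x"
  unfolding transfer_def by (simp add: nn_integral_cmult[symmetric] mult.left_commute)

lemma transfer_zero [simp]: "transfer (\<lambda>y. 0) x = 0"
  unfolding transfer_def by simp

lemma transfer_sum: "transfer (\<lambda>y. \<Sum>i\<in>A. f i y) x = (\<Sum>i\<in>A. transfer (f i) x)"
  by (induction A rule: infinite_finite_induct) (auto simp: transfer_add)

lemma transfer_reflect: "transfer (\<lambda>y. f (- y)) x = transfer f (- x)"
proof -
  have "bij_betw uminus (- {0}) (- {0 :: int})"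
    by (rule bij_betwI[of _ _ _ uminus]) auto
  then have "transfer f (- x) = (\<integral>\<^sup>+j. ennreal (1 / (- x + 2 * real_of_int (- j))\<^sup>2) * f (1 / (- x + 2 * real_of_int (- j)))
                      \<partial>count_space (- {0}))"
    unfolding transfer_def by (intro nn_integral_bij_count_space[symmetric])
  also have "\<dots> = transfer (\<lambda>y. f (- y)) x"
    unfolding transfer_def
  proof (intro nn_integral_cong)
    fix j :: int
    have "- x + 2 * real_of_int (- j) = - (x + 2 * real_of_int j)" by simp
    then show "ennreal (1 / (- x + 2 * real_of_int (- j))\<^sup>2) * f (1 / (- x + 2 * real_of_int (- j)))
      = ennreal (1 / (x + 2 * real_of_int j)\<^sup>2) * f (- (1 / (x + 2 * real_of_int j)))"
      by (simp only: power2_minus divide_minus_right)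
  qed
  finally show ?thesis ..
qed

lemma measurable_transfer [measurable]:
  assumes [measurable]: "f \<in> borel_measurable borel"
  shows "transfer f \<in> borel_measurable borel"
proof -
  interpret C: sigma_finite_measure "count_space (- {0 :: int})"
    by (rule sigma_finite_measure_count_space)
  have "(\<lambda>(x, j). ennreal (1 / (x + 2 * real_of_int j)\<^sup>2) * f (1 / (x + 2 * real_of_int j)))
      \<in> borel_measurable (borel \<Otimes>\<^sub>M count_space (- {0}))"
    by (subst measurable_pair_swap_iff, simp only: case_prod_conv, rule measurable_pair_measure_countable1) auto
  then show ?thesis
    unfolding transfer_def[abs_def] by (rule C.borel_measurable_nn_integral)
qed

text \<open>Summing over the branches is a periodization, so by tiling the integral becomes one over \<open>\<bar>s\<bar> > 1\<close>,
  which inversion maps back to \<open>(-1, 1)\<close>.\<close>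
lemma nn_integral_transfer:
  assumes [measurable]: "f \<in> borel_measurable borel"
  shows "(\<integral>\<^sup>+x. transfer f x \<partial>lborel_I) = (\<integral>\<^sup>+x. f x \<partial>lborel_I)"
proof -
  \<comment> \<open>The cut-off on \<open>1 / s\<close> removes the term \<open>j = 0\<close> of the periodization, except at \<open>s = 0\<close>, where
    \<open>1 / 0 = 0\<close> passes it but the weight \<open>1 / 0\<^sup>2\<close> vanishes.\<close>
  define F where "F s = ennreal (1 / s\<^sup>2) * (f (1 / s) * indicator {-1<..<1} (1 / s))" for s
  have [measurable]: "F \<in> borel_measurable borel" unfolding F_def by measurable
  have "transfer f x = (\<integral>\<^sup>+j. F (x + 2 * real_of_int j) \<partial>count_space UNIV)" if "x \<in> {-1<..<1}" for x
    unfolding transfer_def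
  proof (subst nn_integral_count_space_indicator, simp, intro nn_integral_cong)
    fix j :: int
    show "ennreal (1 / (x + 2 * real_of_int j)\<^sup>2) * f (1 / (x + 2 * real_of_int j)) * indicator (- {0}) j
        = F (x + 2 * real_of_int j)"
    proof (cases "j = 0")
      case False
      then show ?thesis
        using branch_point[OF that False] by (auto simp: F_def split: split_indicator)
    next
      case True
      have "x = 0 \<or> 1 < \<bar>1 / x\<bar>"
        using that by (auto simp: less_divide_eq)
      then have "x = 0 \<or> 1 / x \<notin> {-1<..<1}" by auto
      then show ?thesis
        using True by (auto simp: F_def)
    qed
  qed
  then have "(\<integral>\<^sup>+x. transfer f x \<partial>lborel_I) = (\<integral>\<^sup>+x. (\<integral>\<^sup>+j. F (x + 2 * real_of_int j) \<partial>count_space UNIV) \<partial>lborel_I)"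
    by (intro nn_integral_cong) (auto simp: space_restrict_space)
  also have "\<dots> = (\<integral>\<^sup>+s. F s \<partial>lborel)"
    by (rule nn_integral_tile) measurable
  also have "\<dots> = (\<integral>\<^sup>+s. f s * indicator {-1<..<1} s \<partial>lborel)"
    unfolding F_def by (rule nn_integral_reciprocal) measurable
  also have "\<dots> = (\<integral>\<^sup>+x. f x \<partial>lborel_I)"
    by (subst nn_integral_restrict_space) auto
  finally show ?thesis .
qed

text \<open>The operator does not see null sets: the exceptional set \<open>D\<close> satisfies \<open>\<integral> transfer (indicator D) = 0\<close>, so
  almost no point has a branch point in \<open>D\<close>.\<close>
lemma transfer_mono_AE:
  assumes [measurable]: "f \<in> borel_measurable borel" "g \<in> borel_measurable borel"
    and le: "AE x in lborel_I. f x \<le> g x"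
  shows "AE x in lborel_I. transfer f x \<le> transfer g x"
proof -
  define D where "D = {x. \<not> f x \<le> g x}"
  have [measurable]: "D \<in> sets borel" unfolding D_def by measurable
  have "(\<integral>\<^sup>+x. transfer (indicator D) x \<partial>lborel_I) = (\<integral>\<^sup>+x. indicator D x \<partial>lborel_I)"
    by (rule nn_integral_transfer) measurable
  also have "\<dots> = 0"
    using le by (subst nn_integral_0_iff_AE) (auto simp: D_def measurable_restrict_space1 elim!: eventually_mono)
  finally have "AE x in lborel_I. transfer (indicator D) x = 0"
    by (subst (asm) nn_integral_0_iff_AE) (auto intro: measurable_restrict_space1)
  then show ?thesis
  proof eventually_elim
    case (elim x)
    have "transfer f x \<le> transfer (\<lambda>y. g y + \<infinity> * indicator D y) x"
      unfolding transfer_def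
      by (intro nn_integral_mono mult_left_mono) (auto simp: D_def split: split_indicator)
    also have "\<dots> = transfer g x"
      by (subst transfer_add, subst transfer_cmult) (simp add: elim)
    finally show ?case .
  qed
qed

section \<open>Iterated densities and the Bergman kernel\<close>

definition bergman_kernel :: "real \<Rightarrow> real \<Rightarrow> ennreal" where
  "bergman_kernel x y = ennreal (1 / (1 - x * y)\<^sup>2)"

text \<open>Both sides equal \<open>\<Sum>j\<noteq>0. 1 / (x + 2 j - y)\<^sup>2\<close>, since \<open>s\<^sup>2 (1 - z / s)\<^sup>2 = (s - z)\<^sup>2\<close>; the exchange of \<open>x\<close> and \<open>y\<close>
  is compensated by \<open>j \<mapsto> - j\<close>.\<close>
lemma transfer_kernel_symmetric:
  assumes x: "x \<in> {-1<..<1}" and y: "y \<in> {-1<..<1}"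
  shows "transfer (\<lambda>x. bergman_kernel x y) x = transfer (bergman_kernel x) y"
proof -
  have resolvent: "ennreal (1 / s\<^sup>2) * ennreal (1 / (1 - 1 / s * z)\<^sup>2) = ennreal (1 / (s - z)\<^sup>2)" if "s \<noteq> 0" for s z :: real
  proof -
    have "s\<^sup>2 * (1 - 1 / s * z)\<^sup>2 = (s - z)\<^sup>2"
      unfolding power_mult_distrib[symmetric] using that by (simp add: right_diff_distrib)
    then have "1 / s\<^sup>2 * (1 / (1 - 1 / s * z)\<^sup>2) = 1 / (s - z)\<^sup>2" by simp
    then show ?thesis by (simp add: ennreal_mult[symmetric])
  qed
  have bij: "bij_betw uminus (- {0}) (- {0 :: int})"
    by (rule bij_betwI[of _ _ _ uminus]) auto
  have "transfer (\<lambda>x. bergman_kernel x y) x = (\<integral>\<^sup>+j. ennreal (1 / (x + 2 * real_of_int j - y)\<^sup>2) \<partial>count_space (- {0}))"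
    unfolding transfer_def bergman_kernel_def
    by (intro nn_integral_cong resolvent) (use branch_point(1)[OF x] in fastforce)
  also have "\<dots> = (\<integral>\<^sup>+j. ennreal (1 / (y + 2 * real_of_int (- j) - x)\<^sup>2) \<partial>count_space (- {0}))"
    by (intro nn_integral_cong arg_cong[of _ _ ennreal] arg_cong[of _ _ "\<lambda>u. 1 / u"])
       (simp add: power2_eq_square algebra_simps)
  also have "\<dots> = (\<integral>\<^sup>+j. ennreal (1 / (y + 2 * real_of_int j - x)\<^sup>2) \<partial>count_space (- {0}))"
    by (rule nn_integral_bij_count_space[OF bij])
  also have "\<dots> = transfer (bergman_kernel x) y"
    unfolding transfer_def bergman_kernel_def
    by (intro nn_integral_cong, subst mult.commute[of x], intro resolvent[symmetric])
       (use branch_point(1)[OF y] in fastforce)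
  finally show ?thesis .
qed

lemma funpow_transfer_mono:
  assumes "x \<in> {-1<..<1}" "\<And>y. y \<in> {-1<..<1} \<Longrightarrow> f y \<le> g y"
  shows "(transfer ^^ n) f x \<le> (transfer ^^ n) g x"
  using assms by (induction n arbitrary: x) (auto intro: transfer_mono)

lemma funpow_transfer_cong:
  assumes "x \<in> {-1<..<1}" "\<And>y. y \<in> {-1<..<1} \<Longrightarrow> f y = g y"
  shows "(transfer ^^ n) f x = (transfer ^^ n) g x"
  using assms by (intro antisym funpow_transfer_mono) auto

lemma funpow_transfer_nn_integral:
  assumes "countable I"
  shows "(transfer ^^ n) (\<lambda>x. \<integral>\<^sup>+i. c i * f i x \<partial>count_space I)
       = (\<lambda>x. \<integral>\<^sup>+i. c i * (transfer ^^ n) (f i) x \<partial>count_space I)"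
  by (induction n) (auto simp: transfer_nn_integral[OF assms])

lemma funpow_transfer_add:
  "(transfer ^^ n) (\<lambda>y. f y + g y) = (\<lambda>x. (transfer ^^ n) f x + (transfer ^^ n) g x)"
  by (induction n) (auto simp: transfer_add)

lemma funpow_transfer_cmult: "(transfer ^^ n) (\<lambda>y. c * f y) = (\<lambda>x. c * (transfer ^^ n) f x)"
  by (induction n) (auto simp: transfer_cmult)

lemma funpow_transfer_reflect: "(transfer ^^ n) (\<lambda>y. f (- y)) = (\<lambda>x. (transfer ^^ n) f (- x))"
  by (induction n) (auto simp: transfer_reflect)

lemma measurable_funpow_transfer [measurable]:
  "f \<in> borel_measurable borel \<Longrightarrow> (transfer ^^ n) f \<in> borel_measurable borel"
  by (induction n) auto

lemma nn_integral_funpow_transfer: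
  "f \<in> borel_measurable borel \<Longrightarrow> (\<integral>\<^sup>+x. (transfer ^^ n) f x \<partial>lborel_I) = (\<integral>\<^sup>+x. f x \<partial>lborel_I)"
  by (induction n) (auto simp: nn_integral_transfer)

text \<open>The operators in the two variables commute, because iterates are countably additive; hence the
  symmetry of a single step propagates.\<close>
lemma funpow_transfer_kernel_symmetric:
  assumes "x \<in> {-1<..<1}" and y: "y \<in> {-1<..<1}"
  shows "(transfer ^^ n) (\<lambda>x. bergman_kernel x y) x = (transfer ^^ n) (bergman_kernel x) y"
  using assms(1)
proof (induction n arbitrary: x)
  case (Suc n)
  have "(transfer ^^ Suc n) (\<lambda>x. bergman_kernel x y) x = transfer (\<lambda>x. (transfer ^^ n) (bergman_kernel x) y) x"
    using Suc by (auto intro: transfer_cong)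
  also have "\<dots> = (transfer ^^ n) (\<lambda>z. transfer (\<lambda>x. bergman_kernel x z) x) y"
    unfolding transfer_def[of "\<lambda>x. bergman_kernel x _"] transfer_def[of "\<lambda>x. (transfer ^^ n) (bergman_kernel x) y"]
    by (subst funpow_transfer_nn_integral) auto
  also have "\<dots> = (transfer ^^ n) (transfer (bergman_kernel x)) y"
    using y Suc.prems by (intro funpow_transfer_cong transfer_kernel_symmetric) auto
  finally show ?case by (simp add: funpow_swap1)
qed simp

text \<open>The density after \<open>n\<close> steps of the map when started with Lebesgue measure.\<close>
definition pushed_density :: "nat \<Rightarrow> real \<Rightarrow> ennreal" where
  "pushed_density n = (transfer ^^ n) (\<lambda>_. 1)"

text \<open>The constant 1 is \<open>bergman_kernel x 0\<close> as a function of \<open>x\<close>, so the symmetry moves the evaluation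
  point to 0 and the dependence on \<open>x\<close> into the kernel. Bounds of the kernel in its second variable thereby become
  bounds of \<open>pushed_density n x\<close> in terms of \<open>pushed_density n 0\<close>.\<close>
lemma pushed_density_eq_kernel:
  assumes "x \<in> {-1<..<1}"
  shows "pushed_density n x = (transfer ^^ n) (bergman_kernel x) 0"
  using funpow_transfer_kernel_symmetric[OF assms, of 0 n]
  by (simp add: pushed_density_def bergman_kernel_def)

lemma pushed_density_even: "pushed_density n (- x) = pushed_density n x"
  using funpow_transfer_reflect[of n "\<lambda>_. 1"] by (metis pushed_density_def)

lemma pushed_density_le:
  assumes x: "x \<in> {-1<..<1}"
  shows "pushed_density n x \<le> ennreal (1 / (1 - \<bar>x\<bar>)\<^sup>2) * pushed_density n 0"
proof -
  have "bergman_kernel x y \<le> ennreal (1 / (1 - \<bar>x\<bar>)\<^sup>2) * 1" if "y \<in> {-1<..<1}" for y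
  proof -
    have "\<bar>x * y\<bar> \<le> \<bar>x\<bar> * 1"
      unfolding abs_mult using that by (intro mult_left_mono) auto
    then have "1 - \<bar>x\<bar> \<le> 1 - x * y" by linarith
    then have "(1 - \<bar>x\<bar>)\<^sup>2 \<le> (1 - x * y)\<^sup>2" "0 < (1 - \<bar>x\<bar>)\<^sup>2"
      using x by (auto intro!: power_mono)
    then show ?thesis
      unfolding bergman_kernel_def by (auto intro!: ennreal_leI divide_left_mono mult_pos_pos)
  qed
  then have "(transfer ^^ n) (bergman_kernel x) 0 \<le> (transfer ^^ n) (\<lambda>y. ennreal (1 / (1 - \<bar>x\<bar>)\<^sup>2) * 1) 0"
    by (intro funpow_transfer_mono) auto
  also have "\<dots> = ennreal (1 / (1 - \<bar>x\<bar>)\<^sup>2) * pushed_density n 0"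
    by (simp only: funpow_transfer_cmult pushed_density_def)
  finally show ?thesis
    by (simp only: pushed_density_eq_kernel[OF x])
qed

text \<open>By evenness the kernel may be averaged over \<open>x\<close> and \<open>- x\<close>, and this average is at least 1
  by the tangent bound \<open>1 / (1 - u)\<^sup>2 \<ge> 1 + 2 u\<close>.\<close>
lemma pushed_density_ge:
  assumes x: "x \<in> {-1<..<1}"
  shows "pushed_density n 0 \<le> pushed_density n x"
proof -
  have tangent: "1 + 2 * u \<le> 1 / (1 - u)\<^sup>2" if "\<bar>u\<bar> < 1" for u :: real
  proof -
    have "(1 + 2 * u) * (1 - u)\<^sup>2 = 1 - u\<^sup>2 * (3 - 2 * u)"
      by (simp add: power2_eq_square algebra_simps)
    moreover have "0 \<le> u\<^sup>2 * (3 - 2 * u)"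
      using that by (intro mult_nonneg_nonneg) auto
    ultimately show ?thesis
      using that by (simp add: le_divide_eq)
  qed
  have "2 * 1 \<le> bergman_kernel x y + bergman_kernel (- x) y" if "y \<in> {-1<..<1}" for y
  proof -
    have "\<bar>x * y\<bar> < 1 * 1"
      unfolding abs_mult using x that by (intro mult_strict_mono') auto
    then have "2 \<le> 1 / (1 - x * y)\<^sup>2 + 1 / (1 - (- x) * y)\<^sup>2"
      using tangent[of "x * y"] tangent[of "- (x * y)"] by simp
    then have "ennreal 2 \<le> ennreal (1 / (1 - x * y)\<^sup>2 + 1 / (1 - (- x) * y)\<^sup>2)"
      by (rule ennreal_leI)
    then show ?thesis
      unfolding bergman_kernel_def by (simp add: ennreal_plus[symmetric] del: ennreal_plus)
  qed
  then have "(transfer ^^ n) (\<lambda>y. 2 * 1) 0 \<le> (transfer ^^ n) (\<lambda>y. bergman_kernel x y + bergman_kernel (- x) y) 0"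
    by (intro funpow_transfer_mono) auto
  also have "\<dots> = pushed_density n x + pushed_density n (- x)"
    using x by (simp add: funpow_transfer_add pushed_density_eq_kernel)
  also have "\<dots> = 2 * pushed_density n x"
    by (simp only: pushed_density_even mult_2)
  also have "(transfer ^^ n) (\<lambda>y. 2 * 1) 0 = 2 * pushed_density n 0"
    by (simp only: funpow_transfer_cmult pushed_density_def)
  finally have "2 * pushed_density n 0 \<le> 2 * pushed_density n x" .
  then show ?thesis
    by (subst (asm) ennreal_mult_le_mult_iff) auto
qed

definition density_sum :: "nat \<Rightarrow> real \<Rightarrow> ennreal" where
  "density_sum N x = (\<Sum>n<N. pushed_density n x)"

lemma measurable_density_sum [measurable]: "density_sum N \<in> borel_measurable borel"
  unfolding density_sum_def[abs_def] pushed_density_def by measurable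

lemma density_sum_even: "density_sum N (- x) = density_sum N x"
  unfolding density_sum_def by (simp add: pushed_density_even)

lemma density_sum_le:
  "x \<in> {-1<..<1} \<Longrightarrow> density_sum N x \<le> ennreal (1 / (1 - \<bar>x\<bar>)\<^sup>2) * density_sum N 0"
  unfolding density_sum_def sum_distrib_left by (intro sum_mono pushed_density_le)

lemma density_sum_ge: "x \<in> {-1<..<1} \<Longrightarrow> density_sum N 0 \<le> density_sum N x"
  unfolding density_sum_def by (intro sum_mono pushed_density_ge)

lemma density_sum_mono: "M \<le> N \<Longrightarrow> density_sum M x \<le> density_sum N x"
  unfolding density_sum_def by (intro sum_mono2) auto

lemma transfer_density_sum_le: "transfer (density_sum N) x \<le> density_sum (Suc N) x"
proof -
  have "transfer (density_sum N) x = (\<Sum>n<N. pushed_density (Suc n) x)"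
    unfolding density_sum_def by (subst transfer_sum) (simp add: pushed_density_def)
  then show ?thesis
    unfolding density_sum_def sum.lessThan_Suc_shift by (simp add: add_increasing)
qed

lemma nn_integral_density_sum: "(\<integral>\<^sup>+x. density_sum N x \<partial>lborel_I) = 2 * of_nat N"
proof -
  have "(\<integral>\<^sup>+x. pushed_density n x \<partial>lborel_I) = 2" for n
    unfolding pushed_density_def by (subst nn_integral_funpow_transfer) (auto simp: emeasure_restrict_space space_restrict_space)
  then show ?thesis
    unfolding density_sum_def
    by (subst nn_integral_sum) (auto simp: pushed_density_def mult.commute intro: measurable_restrict_space1)
qed

text \<open>The branches \<open>j = - 1\<close> and \<open>j = 1\<close>. For \<open>x\<close> near 1 the first one stays near the parabolic fixed
  points and has weight near 1; the second one feeds in new mass.\<close>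
lemma transfer_ge_two_branches:
  "ennreal (1 / (2 - x)\<^sup>2) * f (- (1 / (2 - x))) + ennreal (1 / (2 + x)\<^sup>2) * f (1 / (2 + x)) \<le> transfer f x"
proof -
  let ?t = "\<lambda>j::int. ennreal (1 / (x + 2 * real_of_int j)\<^sup>2) * f (1 / (x + 2 * real_of_int j))"
  have "x + 2 * real_of_int (-1) = - (2 - x)" "x + 2 * real_of_int 1 = 2 + x" by simp_all
  then have "ennreal (1 / (2 - x)\<^sup>2) * f (- (1 / (2 - x))) + ennreal (1 / (2 + x)\<^sup>2) * f (1 / (2 + x)) = ?t (-1) + ?t 1"
    by (simp only: power2_minus divide_minus_right)
  also have "\<dots> = (\<integral>\<^sup>+j. ?t j \<partial>count_space {-1, 1})"
    by (subst nn_integral_count_space_finite) (simp_all del: of_int_minus)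
  also have "\<dots> = (\<integral>\<^sup>+j. ?t j * indicator {-1, 1} j \<partial>count_space {-1, 1})"
    by (intro nn_integral_cong) simp
  also have "\<dots> = (\<integral>\<^sup>+j. ?t j * indicator {-1, 1} j \<partial>count_space (- {0}))"
    by (rule nn_integral_count_space_eq) auto
  also have "\<dots> \<le> transfer f x"
    unfolding transfer_def by (intro nn_integral_mono) (auto split: split_indicator)
  finally show ?thesis .
qed

text \<open>On \<open>[0, 1)\<close> the branch \<open>x \<mapsto> 1 / (2 - x)\<close> (up to sign) fixes 1 and has derivative 1 there. Its \<open>i\<close>-th
  iterate has derivative \<open>1 / (i + 1 - i x)\<^sup>2\<close>. Each step of the operator transports what has been collected along this
  branch and adds, through the branch \<open>1 / (2 + x)\<close> of weight at least \<open>1 / 9\<close>, a multiple of the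
  minimum \<open>density_sum N 0\<close>.\<close>
lemma density_sum_ge_parabolic:
  assumes "x \<in> {0..<1}"
  shows "ennreal (1 / 9 * (\<Sum>i<K. 1 / (real i + 1 - real i * x)\<^sup>2)) * density_sum N 0 \<le> density_sum (N + K) x"
  using assms
proof (induction K arbitrary: x)
  case (Suc K)
  define x' where "x' = 1 / (2 - x)"
  have x': "x' \<in> {0..<1}" using Suc.prems by (auto simp: x'_def divide_less_eq)
  define S where "S = (\<Sum>i<K. 1 / (real i + 1 - real i * x')\<^sup>2)"
  have S: "0 \<le> S" unfolding S_def by (intro sum_nonneg) auto
  have "1 / (2 - x)\<^sup>2 * S = (\<Sum>i<K. 1 / (real (Suc i) + 1 - real (Suc i) * x)\<^sup>2)"
    unfolding S_def sum_distrib_left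
  proof (rule sum.cong)
    fix i
    \<comment> \<open>Chain rule for the iterates of \<open>x \<mapsto> 1 / (2 - x)\<close>.\<close>
    have "(2 - x) * (real i + 1 - real i * x') = real (Suc i) + 1 - real (Suc i) * x"
      using Suc.prems by (simp add: x'_def field_simps)
    then have "(2 - x)\<^sup>2 * (real i + 1 - real i * x')\<^sup>2 = (real (Suc i) + 1 - real (Suc i) * x)\<^sup>2"
      by (simp only: power_mult_distrib[symmetric])
    then show "1 / (2 - x)\<^sup>2 * (1 / (real i + 1 - real i * x')\<^sup>2) = 1 / (real (Suc i) + 1 - real (Suc i) * x)\<^sup>2"
      by simp
  qed simp
  then have "(\<Sum>i<Suc K. 1 / (real i + 1 - real i * x)\<^sup>2) = 1 + 1 / (2 - x)\<^sup>2 * S"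
    unfolding sum.lessThan_Suc_shift by simp
  then have "1 / 9 * (\<Sum>i<Suc K. 1 / (real i + 1 - real i * x)\<^sup>2) = 1 / (2 - x)\<^sup>2 * (1 / 9 * S) + 1 / 9"
    by simp
  then have "ennreal (1 / 9 * (\<Sum>i<Suc K. 1 / (real i + 1 - real i * x)\<^sup>2))
    = ennreal (1 / (2 - x)\<^sup>2 * (1 / 9 * S) + 1 / 9)"
    by (rule arg_cong)
  also have "\<dots> = ennreal (1 / (2 - x)\<^sup>2) * ennreal (1 / 9 * S) + ennreal (1 / 9)"
    using S by (simp add: ennreal_mult[symmetric])
  finally have "ennreal (1 / 9 * (\<Sum>i<Suc K. 1 / (real i + 1 - real i * x)\<^sup>2)) * density_sum N 0
     = ennreal (1 / (2 - x)\<^sup>2) * (ennreal (1 / 9 * S) * density_sum N 0) + ennreal (1 / 9) * density_sum N 0"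
    by (simp add: distrib_right mult.assoc)
  also have "\<dots> \<le> ennreal (1 / (2 - x)\<^sup>2) * density_sum (N + K) (- x')
      + ennreal (1 / (2 + x)\<^sup>2) * density_sum (N + K) (1 / (2 + x))"
  proof (intro add_mono mult_mono)
    show "ennreal (1 / 9 * S) * density_sum N 0 \<le> density_sum (N + K) (- x')"
      unfolding density_sum_even S_def using Suc.IH[OF x'] .
    have "(2 + x)\<^sup>2 \<le> 3\<^sup>2" using Suc.prems by (intro power_mono) auto
    then show "ennreal (1 / 9) \<le> ennreal (1 / (2 + x)\<^sup>2)"
      using Suc.prems by (intro ennreal_leI divide_left_mono) auto
    have "density_sum N 0 \<le> density_sum (N + K) 0" by (rule density_sum_mono) simp
    also have "\<dots> \<le> density_sum (N + K) (1 / (2 + x))"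
      using Suc.prems by (intro density_sum_ge) (auto simp: divide_less_eq less_divide_eq)
    finally show "density_sum N 0 \<le> density_sum (N + K) (1 / (2 + x))" .
  qed auto
  also have "\<dots> \<le> transfer (density_sum (N + K)) x"
    unfolding x'_def by (rule transfer_ge_two_branches)
  also have "\<dots> \<le> density_sum (N + Suc K) x"
    using transfer_density_sum_le[of "N + K"] by simp
  finally show ?case .
qed (auto intro: density_sum_ge)

text \<open>Integrating the previous bound with \<open>K = N\<close>: the left-hand side collects
  \<open>\<integral>\<^sub>0\<^sup>1 dx / (i + 1 - i x)\<^sup>2 = 1 / (i + 1)\<close> for \<open>i < N\<close>, whereas the total mass of \<open>density_sum (2 N)\<close> is \<open>4 N\<close>.
  Divergence of the harmonic series thus forces the averages of \<open>pushed_density n 0\<close> to zero.\<close>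
lemma density_sum_0_le: "ennreal (harm N) * density_sum N 0 \<le> 36 * of_nat N"
proof -
  let ?v = "\<lambda>x. \<Sum>i<N. 1 / (real i + 1 - real i * x)\<^sup>2"
  have pos: "0 < real i + 1 - real i * x" if "x \<le> 1" for i x
    using mult_left_mono[OF that, of "real i"] by simp
  have "(\<integral>\<^sup>+x. ennreal (1 / (real i + 1 - real i * x)\<^sup>2) * indicator {0..1} x \<partial>lborel)
      = ennreal (1 / (real i + 1))" for i
  proof -
    have "(\<integral>\<^sup>+x. ennreal (1 / (real i + 1 - real i * x)\<^sup>2) * indicator {0..1} x \<partial>lborel)
       = ennreal ((\<lambda>x. x / ((real i + 1) * (real i + 1 - real i * x))) 1 - (\<lambda>x. x / ((real i + 1) * (real i + 1 - real i * x))) 0)"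
    proof (rule nn_integral_FTC_Icc)
      fix x :: real assume "x \<in> {0..1}"
      then have p: "0 < real i + 1 - real i * x" using pos by auto
      have "((\<lambda>x. x / ((real i + 1) * (real i + 1 - real i * x))) has_real_derivative
          (1 * ((real i + 1) * (real i + 1 - real i * x)) - x * ((real i + 1) * (0 - real i * 1)))
            / (((real i + 1) * (real i + 1 - real i * x)) * ((real i + 1) * (real i + 1 - real i * x)))) (at x)"
        using p by (intro DERIV_divide) (auto intro!: derivative_eq_intros)
      also have "(1 * ((real i + 1) * (real i + 1 - real i * x)) - x * ((real i + 1) * (0 - real i * 1)))
            / (((real i + 1) * (real i + 1 - real i * x)) * ((real i + 1) * (real i + 1 - real i * x)))
          = 1 / (real i + 1 - real i * x)\<^sup>2"
      proof -
        have "1 * ((real i + 1) * (real i + 1 - real i * x)) - x * ((real i + 1) * (0 - real i * 1)) = (real i + 1) * (real i + 1)"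
          by (simp add: algebra_simps)
        then show ?thesis using p by (simp add: power2_eq_square)
      qed
      finally show "((\<lambda>x. x / ((real i + 1) * (real i + 1 - real i * x))) has_real_derivative
          1 / (real i + 1 - real i * x)\<^sup>2) (at x)" .
    qed auto
    then show ?thesis by simp
  qed
  note term_integral = this
  have "(\<integral>\<^sup>+x. ennreal (?v x) * indicator {0..1} x \<partial>lborel)
     = (\<integral>\<^sup>+x. (\<Sum>i<N. ennreal (1 / (real i + 1 - real i * x)\<^sup>2) * indicator {0..1} x) \<partial>lborel)"
    by (intro nn_integral_cong, subst sum_ennreal[symmetric]) (simp_all only: sum_distrib_right zero_le_divide_1_iff zero_le_power2)
  also have "\<dots> = (\<Sum>i<N. ennreal (1 / (real i + 1)))"
    by (subst nn_integral_sum) (simp_all only: term_integral, measurable)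
  also have "\<dots> = ennreal (harm N)"
    by (simp add: sum_ennreal harm_def sum.atLeast1_atMost_eq inverse_eq_divide add.commute)
  finally have v: "(\<integral>\<^sup>+x. ennreal (?v x) * indicator {0..1} x \<partial>lborel) = ennreal (harm N)" .
  have "ennreal (1 / 9) * (ennreal (harm N) * density_sum N 0)
     = (\<integral>\<^sup>+x. ennreal (1 / 9) * ((ennreal (?v x) * indicator {0..1} x) * density_sum N 0) \<partial>lborel)"
    by (subst nn_integral_cmult, simp, subst nn_integral_multc, simp) (simp add: v)
  also have "\<dots> \<le> (\<integral>\<^sup>+x. density_sum (N + N) x * indicator {-1<..<1} x \<partial>lborel)"
  proof (rule nn_integral_mono_AE, use AE_lborel_singleton[of "1::real"] in eventually_elim)
    fix x :: real assume "x \<noteq> 1"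
    have "ennreal (1 / 9) * (ennreal (?v x) * density_sum N 0) \<le> density_sum (N + N) x" if "x \<in> {0..<1}"
    proof -
      have "ennreal (1 / 9 * ?v x) = ennreal (1 / 9) * ennreal (?v x)"
        by (intro ennreal_mult sum_nonneg) auto
      then show ?thesis
        using density_sum_ge_parabolic[OF that, of N N] by (simp only: mult.assoc)
    qed
    then show "ennreal (1 / 9) * ((ennreal (?v x) * indicator {0..1} x) * density_sum N 0)
        \<le> density_sum (N + N) x * indicator {-1<..<1} x"
      using \<open>x \<noteq> 1\<close> by (auto split: split_indicator)
  qed
  also have "\<dots> = 2 * of_nat (N + N)"
    using nn_integral_density_sum[of "N + N"] by (subst (asm) nn_integral_restrict_space) auto
  finally have "ennreal 9 * (ennreal (1 / 9) * (ennreal (harm N) * density_sum N 0)) \<le> ennreal 9 * (2 * of_nat (N + N))"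
    by (rule mult_left_mono) simp
  moreover have "ennreal 9 * (ennreal (1 / 9) * z) = z" for z
    unfolding mult.assoc[symmetric] by (subst ennreal_mult[symmetric]) auto
  moreover have "9 * (2 * of_nat (N + N)) = (36 * of_nat N :: ennreal)"
    by (simp add: distrib_left mult_2[symmetric] mult.assoc[symmetric])
  ultimately show ?thesis by simp
qed

section \<open>Integrable subinvariant densities\<close>

lemma measurable_lborel_I: "f \<in> borel \<rightarrow>\<^sub>M N \<Longrightarrow> f \<in> lborel_I \<rightarrow>\<^sub>M N"
  by (rule measurable_restrict_space1) simp

lemma AE_le_funpow_transfer:
  assumes [measurable]: "h \<in> borel_measurable borel"
    and le: "AE x in lborel_I. h x \<le> transfer h x"
  shows "AE x in lborel_I. h x \<le> (transfer ^^ n) h x"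
proof (induction n)
  case (Suc n)
  have "AE x in lborel_I. transfer h x \<le> transfer ((transfer ^^ n) h) x"
    using Suc by (intro transfer_mono_AE) auto
  with le show ?case by eventually_elim auto
qed simp

text \<open>Cut \<open>h\<close> at height \<open>C\<close>, leaving an error \<open>e C\<close> of small integral. From \<open>h \<le> (transfer ^^ n) h\<close> the
  averages over \<open>n < N\<close> give \<open>N h \<le> C density_sum N + (\<Sum>n<N. (transfer ^^ n) (e C))\<close>. On \<open>[- r, r]\<close> the first
  term is \<open>O(N / harm N)\<close>, and the second one has integral \<open>N \<integral> e C\<close>. Letting first \<open>N\<close>, then \<open>C\<close>,
  tend to infinity proves the claim on \<open>[- r, r]\<close>.\<close>
lemma subinvariant_density_eq_0:
  assumes [measurable]: "h \<in> borel_measurable borel"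
    and fin: "(\<integral>\<^sup>+x. h x \<partial>lborel_I) < \<infinity>"
    and le: "AE x in lborel_I. h x \<le> transfer h x"
  shows "AE x in lborel_I. h x = 0"
proof -
  define e where "e C x = h x - min (h x) (of_nat C)" for C :: nat and x
  have [measurable]: "e C \<in> borel_measurable borel" for C
    unfolding e_def[abs_def] by measurable
  note [measurable (raw)] = measurable_lborel_I
  have e_le: "e C x \<le> h x" for C x
    unfolding e_def by (rule diff_le_self_ennreal)
  have h_split: "h x \<le> of_nat C * 1 + e C x" for C x
    unfolding e_def by (cases "h x \<le> of_nat C") (auto simp: min_def add_diff_inverse_ennreal add_increasing2)
  have e_lim: "(\<lambda>C. \<integral>\<^sup>+x. e C x \<partial>lborel_I) \<longlonglongrightarrow> 0"
  proof -
    have "AE x in lborel_I. h x \<noteq> \<infinity>"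
      using fin by (intro nn_integral_PInf_AE) auto
    then have "AE x in lborel_I. (\<lambda>C. e C x) \<longlonglongrightarrow> 0"
    proof eventually_elim
      case (elim x)
      then obtain C where C: "h x \<le> of_nat C"
        using ennreal_Ex_less_of_nat[of "h x"] by (auto simp: less_top intro: less_imp_le)
      have "e D x = 0" if "D \<ge> C" for D
        using order_trans[OF C of_nat_mono[OF that]] elim unfolding e_def by (simp add: min_absorb1)
      then show ?case
        by (intro tendsto_eventually eventually_sequentiallyI[of C])
    qed
    then have "(\<lambda>C. \<integral>\<^sup>+x. e C x \<partial>lborel_I) \<longlonglongrightarrow> (\<integral>\<^sup>+x. 0 \<partial>lborel_I)"
      using fin by (intro nn_integral_dominated_convergence[where w = h]) (auto simp: e_le)
    then show ?thesis by simp
  qed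
  have local: "(\<integral>\<^sup>+x. h x * indicator {-r..r} x \<partial>lborel_I) \<le> (\<integral>\<^sup>+x. e C x \<partial>lborel_I)"
    if r: "0 < r" "r < 1" for r :: real and C :: nat
  proof -
    let ?a = "\<integral>\<^sup>+x. h x * indicator {-r..r} x \<partial>lborel_I"
    let ?\<epsilon> = "\<integral>\<^sup>+x. e C x \<partial>lborel_I"
    define B where "B = real C * (1 / (1 - r)\<^sup>2) * 2"
    have B: "0 \<le> B" unfolding B_def by simp
    have "?a \<le> (\<integral>\<^sup>+x. h x \<partial>lborel_I)" "?\<epsilon> \<le> (\<integral>\<^sup>+x. h x \<partial>lborel_I)"
      by (intro nn_integral_mono; auto split: split_indicator simp: e_le)+
    then have "?a < \<infinity>" "?\<epsilon> < \<infinity>" using fin by (auto simp: le_less_trans)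
    then obtain a \<epsilon> where a: "?a = ennreal a" "0 \<le> a" and \<epsilon>: "?\<epsilon> = ennreal \<epsilon>" "0 \<le> \<epsilon>"
      by (auto simp: less_top_ennreal)
    have iterate: "AE x in lborel_I. h x \<le> of_nat C * pushed_density n x + (transfer ^^ n) (e C) x" for n
      using AE_le_funpow_transfer[OF assms(1) le, of n] AE_space[of lborel_I]
    proof eventually_elim
      case (elim x)
      note elim(1)
      also have "(transfer ^^ n) h x \<le> (transfer ^^ n) (\<lambda>x. of_nat C * 1 + e C x) x"
        using elim(2) by (intro funpow_transfer_mono h_split) (auto simp: space_restrict_space)
      finally show ?case
        by (simp only: funpow_transfer_add funpow_transfer_cmult pushed_density_def)
    qed
    have bound: "harm N * a \<le> 36 * B + harm N * \<epsilon>" if N: "N \<ge> 1" for N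
    proof -
      have "AE x in lborel_I. \<forall>n. h x \<le> of_nat C * pushed_density n x + (transfer ^^ n) (e C) x"
        using iterate by (simp add: AE_all_countable)
      then have "AE x in lborel_I. of_nat N * (h x * indicator {-r..r} x)
         \<le> of_nat C * (ennreal (1 / (1 - r)\<^sup>2) * density_sum N 0) + (\<Sum>n<N. (transfer ^^ n) (e C) x)"
      proof eventually_elim
        case (elim x)
        show ?case
        proof (cases "x \<in> {-r..r}")
          case True
          have "(\<Sum>n<N. h x) \<le> (\<Sum>n<N. of_nat C * pushed_density n x + (transfer ^^ n) (e C) x)"
            using elim by (intro sum_mono) auto
          also have "\<dots> = of_nat C * density_sum N x + (\<Sum>n<N. (transfer ^^ n) (e C) x)"
            by (simp add: sum.distrib density_sum_def sum_distrib_left)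
          also have "density_sum N x \<le> ennreal (1 / (1 - \<bar>x\<bar>)\<^sup>2) * density_sum N 0"
            using True r by (intro density_sum_le) auto
          also have "ennreal (1 / (1 - \<bar>x\<bar>)\<^sup>2) \<le> ennreal (1 / (1 - r)\<^sup>2)"
            using True r by (intro ennreal_leI divide_left_mono power_mono) auto
          finally show ?thesis
            using True by (simp add: add_mono mult_left_mono mult_right_mono)
        qed simp
      qed
      then have "(\<integral>\<^sup>+x. of_nat N * (h x * indicator {-r..r} x) \<partial>lborel_I)
        \<le> (\<integral>\<^sup>+x. of_nat C * (ennreal (1 / (1 - r)\<^sup>2) * density_sum N 0) + (\<Sum>n<N. (transfer ^^ n) (e C) x) \<partial>lborel_I)"
        by (rule nn_integral_mono_AE)
      also have "\<dots> = of_nat C * (ennreal (1 / (1 - r)\<^sup>2) * density_sum N 0) * 2 + of_nat N * ?\<epsilon>"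
        by (simp add: nn_integral_add nn_integral_sum nn_integral_funpow_transfer emeasure_restrict_space space_restrict_space)
      finally have "ennreal (harm N) * (of_nat N * ?a)
         \<le> ennreal (harm N) * (of_nat C * (ennreal (1 / (1 - r)\<^sup>2) * density_sum N 0) * 2 + of_nat N * ?\<epsilon>)"
        by (intro mult_left_mono) (simp_all add: nn_integral_cmult)
      also have "\<dots> = ennreal B * (ennreal (harm N) * density_sum N 0) + ennreal (harm N) * (of_nat N * ?\<epsilon>)"
      proof -
        have "ennreal B = of_nat C * ennreal (1 / (1 - r)\<^sup>2) * 2"
          unfolding B_def ennreal_of_nat_eq_real_of_nat
          by (subst ennreal_mult, simp, simp, subst ennreal_mult) simp_all
        then show ?thesis by (simp only: distrib_left mult_ac)
      qed
      also have "\<dots> \<le> ennreal B * (36 * of_nat N) + ennreal (harm N) * (of_nat N * ?\<epsilon>)"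
        by (intro add_mono mult_left_mono density_sum_0_le) auto
      finally have "ennreal (harm N * (real N * a)) \<le> ennreal (B * (36 * real N) + harm N * (real N * \<epsilon>))"
        using a \<epsilon> B harm_nonneg[of N, where 'a = real]
        by (simp add: ennreal_mult ennreal_of_nat_eq_real_of_nat)
      then have "real N * (harm N * a) \<le> real N * (36 * B + harm N * \<epsilon>)"
        using a \<epsilon> B harm_nonneg[of N, where 'a = real]
        by (subst (asm) ennreal_le_iff) (auto simp: algebra_simps)
      then show ?thesis using N by simp
    qed
    have "a \<le> \<epsilon>"
    proof (rule ccontr)
      assume "\<not> a \<le> \<epsilon>"
      have "eventually (\<lambda>N. 36 * B / (a - \<epsilon>) < (harm N :: real)) sequentially"
        using harm_at_top by (auto simp: filterlim_at_top_dense)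
      then have "eventually (\<lambda>N. N \<ge> 1 \<and> 36 * B / (a - \<epsilon>) < (harm N :: real)) sequentially"
        using eventually_ge_at_top by eventually_elim auto
      then obtain N where "N \<ge> 1" "36 * B / (a - \<epsilon>) < (harm N :: real)"
        by (auto simp: eventually_sequentially)
      with bound[of N] \<open>\<not> a \<le> \<epsilon>\<close> show False
        by (auto simp: divide_less_eq algebra_simps)
    qed
    then show ?thesis using a \<epsilon> by (simp add: ennreal_leI)
  qed
  have "AE x in lborel_I. h x * indicator {-(1 - 1 / real (k + 2))..1 - 1 / real (k + 2)} x = 0" for k
  proof -
    have "(\<integral>\<^sup>+x. h x * indicator {-(1 - 1 / real (k + 2))..1 - 1 / real (k + 2)} x \<partial>lborel_I) \<le> 0"
      by (rule LIMSEQ_le_const[OF e_lim], intro exI[of _ 0] allI impI local) auto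
    then show ?thesis
      by (subst (asm) le_zero_eq, subst (asm) nn_integral_0_iff_AE) auto
  qed
  then have "AE x in lborel_I. \<forall>k. h x * indicator {-(1 - 1 / real (k + 2))..1 - 1 / real (k + 2)} x = 0"
    unfolding AE_all_countable by blast
  then show ?thesis
    using AE_space
  proof eventually_elim
    case (elim x)
    then have "0 < 1 - \<bar>x\<bar>" by (auto simp: space_restrict_space)
    then obtain k where "1 / real (Suc k) < 1 - \<bar>x\<bar>"
      using nat_approx_posE by blast
    moreover have "1 / real (k + 2) \<le> 1 / real (Suc k)"
      by (intro divide_left_mono) auto
    ultimately have "x \<in> {-(1 - 1 / real (k + 2))..1 - 1 / real (k + 2)}" by auto
    with elim(1) show ?case
      by (metis indicator_simps(1) mult.right_neutral)
  qed
qed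

section \<open>Uniqueness of Fourier coefficients\<close>

lemma integrable_mult_bounded:
  fixes G u :: "'a \<Rightarrow> complex"
  assumes G: "integrable M G" and u: "u \<in> borel_measurable M" "\<And>t. norm (u t) \<le> B"
  shows "integrable M (\<lambda>t. G t * u t)"
proof (rule Bochner_Integration.integrable_bound)
  show "integrable M (\<lambda>t. B * norm (G t))" using G by simp
  show "(\<lambda>t. G t * u t) \<in> borel_measurable M" using G u by measurable
  show "AE t in M. norm (G t * u t) \<le> norm (B * norm (G t))"
  proof (rule AE_I2)
    fix t
    have "norm (G t * u t) \<le> norm (G t) * B"
      unfolding norm_mult using u(2)[of t] by (intro mult_left_mono) auto
    also have "\<dots> \<le> norm (B * norm (G t))" by (simp add: mult.commute)
    finally show "norm (G t * u t) \<le> norm (B * norm (G t))" .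
  qed
qed

abbreviation fourier_mode :: "int \<Rightarrow> real \<Rightarrow> complex" where
  "fourier_mode n t \<equiv> cis (pi * of_int n * t)"

lemma fourier_mode_mult: "fourier_mode m t * fourier_mode n t = fourier_mode (m + n) t"
  by (simp add: cis_mult algebra_simps)

lemma measurable_cis [measurable]: "cis \<in> borel_measurable borel"
  unfolding cis_conv_exp by measurable

lemma integrable_mult_cont_circle:
  fixes G :: "real \<Rightarrow> complex" and c :: "complex \<Rightarrow> real"
  assumes G: "integrable lborel_I G" and c: "continuous_on UNIV c"
  shows "integrable lborel_I (\<lambda>t. G t * of_real (c (fourier_mode 1 t)))"
proof -
  have "compact (c ` sphere 0 1)"
    by (intro compact_continuous_image continuous_on_subset[OF c]) auto
  then obtain B where B: "\<And>z. z \<in> sphere 0 1 \<Longrightarrow> \<bar>c z\<bar> \<le> B"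
    using compact_imp_bounded bounded_iff by (metis imageI real_norm_def)
  have [measurable]: "c \<in> borel_measurable borel"
    by (rule borel_measurable_continuous_onI[OF c])
  show ?thesis
  proof (rule integrable_mult_bounded[OF G])
    show "(\<lambda>t. of_real (c (fourier_mode 1 t)) :: complex) \<in> borel_measurable lborel_I"
      by (rule measurable_restrict_space1) measurable
    show "norm (of_real (c (fourier_mode 1 t)) :: complex) \<le> B" for t
      using B by simp
  qed
qed

text \<open>The functions all of whose Fourier coefficients vanish are closed under multiplication by
  the real and imaginary parts of \<open>exp (\<i> \<pi> t)\<close>, which only shift the modes. The induction over the
  polynomial therefore has to range over all such \<open>G\<close>, so that products can be absorbed one factor at a time.\<close>
lemma integral_mult_polynomial_circle:
  assumes "real_polynomial_function p"
    and "integrable lborel_I G" "\<And>n. (\<integral>t. G t * fourier_mode n t \<partial>lborel_I) = 0"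
  shows "(\<integral>t. G t * of_real (p (fourier_mode 1 t)) * fourier_mode n t \<partial>lborel_I) = 0"
  using assms
proof (induction p arbitrary: G n)
  case (linear f)
  have intg: "integrable lborel_I (\<lambda>t. G t * fourier_mode k t)" for k
    by (rule integrable_mult_bounded[OF linear(2), of _ 1])
       (auto intro!: measurable_restrict_space1)
  define u v :: complex where "u = (f 1 - \<i> * f \<i>) / 2" and "v = (f 1 + \<i> * f \<i>) / 2"
  have f_cis: "of_real (f (fourier_mode 1 t)) = u * fourier_mode 1 t + v * fourier_mode (- 1) t" for t
  proof -
    interpret f: bounded_linear f by fact
    have "f (cis a) = cos a * f 1 + sin a * f \<i>" for a
    proof -
      have "cis a = cos a *\<^sub>R 1 + sin a *\<^sub>R \<i>" by (simp add: complex_eq_iff)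
      then show ?thesis by (simp only: f.add f.scaleR real_scaleR_def)
    qed
    then show ?thesis
      by (simp add: u_def v_def complex_eq_iff field_simps)
  qed
  have "(\<lambda>t. G t * of_real (f (fourier_mode 1 t)) * fourier_mode n t)
      = (\<lambda>t. u * (G t * fourier_mode (1 + n) t) + v * (G t * fourier_mode (- 1 + n) t))"
    unfolding f_cis fourier_mode_mult[symmetric] by (rule ext) (simp only: ring_distribs mult_ac)
  then show ?case
    by (simp only: Bochner_Integration.integral_add[OF integrable_mult_right integrable_mult_right, OF intg intg]
          integral_mult_right_zero linear(3) mult_zero_right add_0_left)
next
  case (const c)
  have "(\<lambda>t. G t * of_real c * fourier_mode n t) = (\<lambda>t. of_real c * (G t * fourier_mode n t))"
    by (simp only: mult_ac)
  then show ?case by (simp only: integral_mult_right_zero const mult_zero_right)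
next
  case (add p q)
  have cont: "continuous_on UNIV p" "continuous_on UNIV q"
    using add.hyps continuous_real_polymonial_function continuous_at_imp_continuous_on by blast+
  have intg: "integrable lborel_I (\<lambda>t. G t * of_real (r (fourier_mode 1 t)) * fourier_mode n t)"
    if "continuous_on UNIV r" for r
    by (rule integrable_mult_bounded[OF integrable_mult_cont_circle[OF add.prems(1) that], of _ 1])
       (auto intro!: measurable_restrict_space1)
  have "(\<lambda>t. G t * of_real (p (fourier_mode 1 t) + q (fourier_mode 1 t)) * fourier_mode n t)
    = (\<lambda>t. G t * of_real (p (fourier_mode 1 t)) * fourier_mode n t + G t * of_real (q (fourier_mode 1 t)) * fourier_mode n t)"
    by (simp only: of_real_add ring_distribs)
  then show ?case
    by (simp only: Bochner_Integration.integral_add[OF intg intg, OF cont] add.IH[OF add.prems] add_0_left)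
next
  case (mult p q)
  have cont: "continuous_on UNIV p"
    using mult.hyps continuous_real_polymonial_function continuous_at_imp_continuous_on by blast
  have "(\<integral>t. (G t * of_real (p (fourier_mode 1 t))) * of_real (q (fourier_mode 1 t)) * fourier_mode n t \<partial>lborel_I) = 0"
    using mult.IH(1)[OF mult.prems] by (intro mult.IH(2) integrable_mult_cont_circle[OF mult.prems(1) cont]) auto
  then show ?case by (simp only: of_real_mult mult.assoc)
qed

text \<open>Stone--Weierstrass on the unit circle, considered as a compact subset of the plane.\<close>
lemma integral_mult_cont_circle:
  fixes G :: "real \<Rightarrow> complex" and c :: "complex \<Rightarrow> real"
  assumes G: "integrable lborel_I G" "\<And>n. (\<integral>t. G t * fourier_mode n t \<partial>lborel_I) = 0"
    and c: "continuous_on UNIV c"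
  shows "(\<integral>t. G t * of_real (c (fourier_mode 1 t)) \<partial>lborel_I) = 0"
proof -
  let ?J = "\<integral>t. G t * of_real (c (fourier_mode 1 t)) \<partial>lborel_I"
  define n where "n = (\<integral>t. norm (G t) \<partial>lborel_I)"
  have "norm ?J \<le> 0 + \<epsilon>" if "\<epsilon> > 0" for \<epsilon>
  proof -
    have n0: "0 \<le> n" by (simp add: n_def)
    then have "0 < \<epsilon> / (n + 1)" by (intro divide_pos_pos that add_nonneg_pos n0 zero_less_one)
    then obtain p where p: "real_polynomial_function p"
        "\<And>z. z \<in> sphere 0 1 \<Longrightarrow> \<bar>c z - p z\<bar> < \<epsilon> / (n + 1)"
      using Stone_Weierstrass_real_polynomial_function[of "sphere 0 1" c] continuous_on_subset[OF c]
      by (metis compact_sphere subset_UNIV)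
    have cont: "continuous_on UNIV p"
      using p(1) continuous_real_polymonial_function continuous_at_imp_continuous_on by blast
    have "?J = ?J - (\<integral>t. G t * of_real (p (fourier_mode 1 t)) \<partial>lborel_I)"
      using integral_mult_polynomial_circle[OF p(1) G, of 0] by simp
    also have "\<dots> = (\<integral>t. G t * of_real (c (fourier_mode 1 t)) - G t * of_real (p (fourier_mode 1 t)) \<partial>lborel_I)"
      by (rule Bochner_Integration.integral_diff[symmetric]) (intro integrable_mult_cont_circle G c cont)+
    also have "norm \<dots> \<le> (\<integral>t. \<epsilon> / (n + 1) * norm (G t) \<partial>lborel_I)"
    proof (rule Bochner_Integration.integral_norm_bound_integral)
      show "integrable lborel_I (\<lambda>t. G t * of_real (c (fourier_mode 1 t)) - G t * of_real (p (fourier_mode 1 t)))"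
        by (intro Bochner_Integration.integrable_diff integrable_mult_cont_circle G c cont)
      show "norm (G t * of_real (c (fourier_mode 1 t)) - G t * of_real (p (fourier_mode 1 t)))
          \<le> \<epsilon> / (n + 1) * norm (G t)" for t
      proof -
        have "\<bar>c (fourier_mode 1 t) - p (fourier_mode 1 t)\<bar> \<le> \<epsilon> / (n + 1)"
          using p(2)[of "fourier_mode 1 t"] by simp
        then have "norm (of_real (c (fourier_mode 1 t) - p (fourier_mode 1 t)) * G t) \<le> \<epsilon> / (n + 1) * norm (G t)"
          unfolding norm_mult norm_of_real by (rule mult_right_mono) simp
        then show ?thesis by (simp only: of_real_diff left_diff_distrib mult.commute[of "G t"])
      qed
    qed (use G(1) in auto)
    also have "\<dots> = \<epsilon> * (n / (n + 1))" by (simp add: n_def)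
    also have "\<dots> \<le> \<epsilon> * 1" using n0 that by (intro mult_left_mono) (auto simp: divide_le_eq)
    finally show ?thesis by simp
  qed
  then have "norm ?J \<le> 0" by (rule field_le_epsilon)
  then show ?thesis by simp
qed

lemma cis_pi_inj:
  assumes "t \<in> {-1<..<1}" "s \<in> {-1..1}" "cis (pi * t) = cis (pi * s)"
  shows "t = s"
proof -
  from assms(3) have "cis (pi * t - pi * s) = 1"
    by (simp add: cis_divide[symmetric])
  then have "cos (pi * t - pi * s) = 1" by (simp add: complex_eq_iff)
  then obtain k :: int where "pi * t - pi * s = of_int k * 2 * pi"
    by (auto simp: cos_one_2pi_int)
  then have "pi * (t - s) = pi * (2 * of_int k)" by (simp add: algebra_simps)
  then have k: "t - s = 2 * of_int k" by simp
  then have "\<bar>2 * real_of_int k\<bar> < 2" using assms(1,2) by auto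
  then have "k = 0" by linarith
  then show ?thesis using k by simp
qed

text \<open>The indicator of an open subset of \<open>(-1, 1)\<close> is a bounded pointwise limit of continuous functions on the
  circle: truncated multiples of the distance to the closed set of those \<open>exp (\<i> \<pi> t)\<close> with \<open>t\<close> in the closed
  interval but outside the open set. Injectivity of \<open>exp (\<i> \<pi> t)\<close> for \<open>t\<close> in the open interval makes the two sets correspond.\<close>
lemma integral_open_eq_0:
  assumes G: "integrable lborel_I G" "\<And>n. (\<integral>t. G t * fourier_mode n t \<partial>lborel_I) = 0"
    and U: "open U"
  shows "(\<integral>t. indicator U t *\<^sub>R G t \<partial>lborel_I) = 0"
proof -
  define C where "C = (\<lambda>t. cis (pi * t)) ` ({-1..1} - (U \<inter> {-1<..<1}))"
  have "compact C"
    unfolding C_def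
    by (intro compact_continuous_image continuous_intros compact_diff) (auto intro: U)
  then have clC: "closed C" by (rule compact_imp_closed)
  have "cis (pi * 1) \<in> C" unfolding C_def by (intro imageI) simp
  then have C_ne: "C \<noteq> {}" by blast
  have memC: "cis (pi * t) \<in> C \<longleftrightarrow> t \<notin> U" if "t \<in> {-1<..<1}" for t
  proof
    assume "cis (pi * t) \<in> C"
    then obtain s where s: "s \<in> {-1..1}" "s \<notin> U \<inter> {-1<..<1}" "cis (pi * t) = cis (pi * s)"
      unfolding C_def by blast
    with cis_pi_inj[OF that s(1,3)] that show "t \<notin> U" by blast
  next
    assume "t \<notin> U"
    with that show "cis (pi * t) \<in> C" unfolding C_def by (intro imageI) auto
  qed
  define c where "c k z = min 1 (real k * infdist z C)" for k z
  have cont: "continuous_on UNIV (c k)" for k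
    unfolding c_def by (intro continuous_intros)
  have lim: "(\<lambda>k. c k z) \<longlonglongrightarrow> indicator (- C) z" for z
  proof (cases "z \<in> C")
    case True
    then show ?thesis by (simp add: c_def)
  next
    case False
    then have "0 < infdist z C"
      using in_closed_iff_infdist_zero[OF clC C_ne] infdist_nonneg[of z C] by (metis less_eq_real_def)
    then obtain N where N: "1 < real N * infdist z C" using reals_Archimedean3 by blast
    have "c k z = 1" if "k \<ge> N" for k
    proof -
      have "real N * infdist z C \<le> real k * infdist z C"
        using that by (intro mult_right_mono infdist_nonneg) auto
      with N show ?thesis by (simp add: c_def)
    qed
    then show ?thesis
      using False by (auto intro!: tendsto_eventually eventually_sequentiallyI[of N])
  qed
  have "(\<lambda>k. \<integral>t. G t * of_real (c k (fourier_mode 1 t)) \<partial>lborel_I) \<longlonglongrightarrow> (\<integral>t. indicator U t *\<^sub>R G t \<partial>lborel_I)"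
  proof (rule integral_dominated_convergence[where w = "\<lambda>t. norm (G t)"])
    show "AE t in lborel_I. (\<lambda>k. G t * of_real (c k (fourier_mode 1 t))) \<longlonglongrightarrow> indicator U t *\<^sub>R G t"
      using AE_space
    proof eventually_elim
      case (elim t)
      then have "t \<in> {-1<..<1}" by (simp add: space_restrict_space)
      then have "indicator (- C) (fourier_mode 1 t) = (indicator U t :: real)"
        using memC[of t] by (auto simp: indicator_def)
      moreover have "(\<lambda>k. G t * of_real (c k (fourier_mode 1 t))) \<longlonglongrightarrow> G t * of_real (indicator (- C) (fourier_mode 1 t))"
        by (intro tendsto_intros lim)
      ultimately show ?case
        by (simp add: scaleR_conv_of_real mult.commute)
    qed
    show "AE t in lborel_I. norm (G t * of_real (c k (fourier_mode 1 t))) \<le> norm (G t)" for k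
      by (rule AE_I2) (auto simp: norm_mult c_def infdist_nonneg intro!: mult_left_le)
    show "(\<lambda>t. indicator U t *\<^sub>R G t) \<in> borel_measurable lborel_I"
      using G(1) U by (intro borel_measurable_scaleR) (auto intro!: measurable_restrict_space1)
  qed (use G(1) integrable_mult_cont_circle[OF G(1) cont] in auto)
  moreover have "(\<integral>t. G t * of_real (c k (fourier_mode 1 t)) \<partial>lborel_I) = 0" for k
    by (rule integral_mult_cont_circle[OF G cont])
  ultimately show ?thesis
    using LIMSEQ_unique by (simp only: LIMSEQ_const_iff)
qed

lemma fourier_uniqueness:
  assumes G: "integrable lborel_I G" "\<And>n. (\<integral>t. G t * fourier_mode n t \<partial>lborel_I) = 0"
  shows "AE t in lborel_I. G t = 0"
proof -
  interpret I: finite_measure lborel_I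
    by (rule finite_measureI) (simp add: space_restrict_space emeasure_restrict_space)
  \<comment> \<open>The induction runs over Borel sets of the line, which need not be sets of \<open>lborel_I\<close>; extending \<open>G\<close> by zero
    repairs this.\<close>
  define G' where "G' t = indicator {-1<..<1} t *\<^sub>R G t" for t
  have G': "integrable lborel G'"
    using G(1) unfolding G'_def by (subst (asm) integrable_restrict_space) auto
  have int: "set_integrable lborel A G'" if "A \<in> sets borel" for A
    unfolding set_integrable_def using that by (intro integrable_mult_indicator G') auto
  have eq: "(LINT t:A|lborel. G' t) = (\<integral>t. indicator A t *\<^sub>R G t \<partial>lborel_I)" for A
    unfolding set_lebesgue_integral_def G'_def
    by (subst integral_restrict_space) (auto simp: mult_ac)
  show ?thesis
  proof (rule I.density_zero[OF G(1)])
    fix A assume "A \<in> sets lborel_I"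
    then have "A \<in> sets (borel :: real measure)"
      by (auto simp: sets_restrict_space_iff)
    then have A: "A \<in> sigma_sets UNIV {S. open S}" by (simp add: sets_borel)
    have stable: "Int_stable {S :: real set. open S}" by (auto simp: Int_stable_def)
    have sub: "{S :: real set. open S} \<subseteq> Pow UNIV" by auto
    from stable sub A
    have "(LINT t:A|lborel. G' t) = 0"
    proof (induction rule: sigma_sets_induct_disjoint)
      case (basic A)
      then show ?case unfolding eq by (intro integral_open_eq_0[OF G]) simp
    next
      case (compl A)
      have A: "A \<in> sets borel" using compl.hyps by (simp add: sets_borel)
      have "(LINT t:UNIV|lborel. G' t) = (LINT t:(UNIV - A) \<union> A|lborel. G' t)" by simp
      also have "\<dots> = (LINT t:UNIV - A|lborel. G' t) + (LINT t:A|lborel. G' t)"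
        using A by (intro set_integral_Un int) auto
      finally show ?case
        using compl.IH integral_open_eq_0[OF G open_UNIV] unfolding eq by simp
    next
      case (union A)
      have A: "A i \<in> sets borel" for i using union.hyps by (auto simp: sets_borel)
      have "(LINT t:(\<Union>i. A i)|lborel. G' t) = (\<Sum>i. (LINT t:A i|lborel. G' t))"
        using A union.hyps(1) by (intro lebesgue_integral_countable_add int) (auto simp: disjoint_family_on_def)
      then show ?case by (simp add: union.IH)
    qed (simp add: set_lebesgue_integral_def)
    then show "set_lebesgue_integral lborel_I A G = 0"
      unfolding eq by (simp add: set_lebesgue_integral_def)
  qed
qed

section \<open>From the moment conditions to the transfer operator\<close>

definition forward_diff :: "(int \<Rightarrow> complex) \<Rightarrow> int \<Rightarrow> complex" where
  "forward_diff f n = f (n + 1) - f n"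

lemma funpow_forward_diff_diff: "(forward_diff ^^ r) (\<lambda>n. f n - g n) = (\<lambda>n. (forward_diff ^^ r) f n - (forward_diff ^^ r) g n)"
  by (induction r) (auto simp: forward_diff_def fun_eq_iff)

lemma funpow_forward_diff_cmult: "(forward_diff ^^ r) (\<lambda>n. c * f n) = (\<lambda>n. c * (forward_diff ^^ r) f n)"
  by (induction r) (auto simp: forward_diff_def fun_eq_iff right_diff_distrib)

lemma funpow_forward_diff_sum: "(forward_diff ^^ r) (\<lambda>n. \<Sum>i\<in>A. f i n) = (\<lambda>n. \<Sum>i\<in>A. (forward_diff ^^ r) (f i) n)"
  by (induction r) (auto simp: forward_diff_def fun_eq_iff sum_subtractf)

lemma funpow_forward_diff_fourier_mode:
  "(forward_diff ^^ r) (\<lambda>n. fourier_mode n t) = (\<lambda>n. fourier_mode n t * (fourier_mode 1 t - 1) ^ r)"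
proof (induction r)
  case (Suc r)
  have "fourier_mode (n + 1) t = fourier_mode n t * fourier_mode 1 t" for n
    by (rule fourier_mode_mult[symmetric])
  then have "forward_diff (\<lambda>n. fourier_mode n t * c) = (\<lambda>n. fourier_mode n t * ((fourier_mode 1 t - 1) * c))" for c
    by (intro ext) (simp only: forward_diff_def left_diff_distrib right_diff_distrib mult_1 mult.assoc)
  then show ?case
    by (simp only: funpow.simps o_apply Suc.IH power_Suc)
qed simp

lemma funpow_forward_diff_monomial: "k < r \<Longrightarrow> (forward_diff ^^ r) (\<lambda>n. of_int n ^ k) = (\<lambda>n. 0)"
proof (induction r arbitrary: k)
  case (Suc r)
  have "forward_diff (\<lambda>n. of_int n ^ k) = (\<lambda>n. \<Sum>i<k. of_nat (k choose i) * of_int n ^ i)"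
    by (simp add: forward_diff_def[abs_def] binomial_ring lessThan_Suc_atMost[symmetric])
  then have "(forward_diff ^^ Suc r) (\<lambda>n. of_int n ^ k) = (\<lambda>n. \<Sum>i<k. of_nat (k choose i) * (forward_diff ^^ r) (\<lambda>n. of_int n ^ i) n)"
    by (simp only: funpow_Suc_right o_apply funpow_forward_diff_sum funpow_forward_diff_cmult)
  also have "\<dots> = (\<lambda>n. 0)"
    using Suc by (auto intro!: sum.neutral)
  finally show ?case .
qed simp

text \<open>Vanishing integrals pass to differences only because every single integrand is integrable,
  for the Bochner integral of a nonintegrable function is 0 by convention.\<close>
lemma integral_funpow_forward_diff:
  fixes B :: "int \<Rightarrow> 'a \<Rightarrow> complex"
  assumes "\<And>n. integrable M (B n)" "\<And>n. (\<integral>t. B n t \<partial>M) = 0"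
  shows "integrable M (\<lambda>t. (forward_diff ^^ r) (\<lambda>n. B n t) n) \<and> (\<integral>t. (forward_diff ^^ r) (\<lambda>n. B n t) n \<partial>M) = 0"
  using assms by (induction r arbitrary: n) (auto simp: forward_diff_def)

text \<open>The test functions of the first family; evaluated at \<open>1 / t\<close> they are those of the second.\<close>
definition taylor_test :: "nat \<Rightarrow> nat \<Rightarrow> int \<Rightarrow> real \<Rightarrow> complex" where
  "taylor_test N m n t =
     (exp (\<i> * of_real (pi * of_int n * t)) - (\<Sum>k<N. 1 / fact k * (\<i> * of_real (pi * of_int n * t)) ^ k))
       / (\<i> * of_real t) ^ m"

lemma measurable_taylor_test [measurable]: "taylor_test N m n \<in> borel_measurable borel"
  unfolding taylor_test_def[abs_def] by measurable

text \<open>The Taylor remainder of \<open>exp (\<i> x)\<close> of order \<open>N\<close> is \<open>O(\<bar>x\<bar>^N)\<close> and, for positive \<open>N\<close>, also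
  \<open>O(\<bar>x\<bar>^(N - 1))\<close>, uniformly on the line. The two admissible exponents of the denominator match these two estimates.\<close>
lemma taylor_test_bounded:
  assumes "m = N \<or> Suc m = N"
  shows "\<exists>B. \<forall>t. norm (taylor_test N m n t) \<le> B"
proof -
  have quot: "(x * \<bar>t\<bar>) ^ k * c / \<bar>t\<bar> ^ k \<le> x ^ k * c" if "0 \<le> x" "0 \<le> c" for x c t :: real and k
    using that by (cases "t = 0"; cases "k = 0") (auto simp: power_mult_distrib)
  have bound: "norm (taylor_test N m n t) \<le> (pi * \<bar>of_int n\<bar>) ^ m * c"
    if "norm (exp (\<i> * of_real (pi * of_int n * t)) - (\<Sum>k<N. 1 / fact k * (\<i> * of_real (pi * of_int n * t)) ^ k))
        \<le> \<bar>pi * of_int n * t\<bar> ^ m * c" "0 \<le> c" for t c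
  proof -
    have "norm (taylor_test N m n t) \<le> \<bar>pi * of_int n * t\<bar> ^ m * c / \<bar>t\<bar> ^ m"
      unfolding taylor_test_def norm_divide norm_power norm_mult[of \<i>] norm_of_real
      using that(1) by (auto intro!: divide_right_mono)
    also have "\<dots> = ((pi * \<bar>of_int n\<bar>) * \<bar>t\<bar>) ^ m * c / \<bar>t\<bar> ^ m"
      by (simp add: abs_mult)
    also have "\<dots> \<le> (pi * \<bar>of_int n\<bar>) ^ m * c"
      using that(2) by (intro quot) auto
    finally show ?thesis .
  qed
  consider "N = 0" "m = 0" | k where "N = Suc k" "m = Suc k" | k where "N = Suc k" "m = k"
    using assms by (cases N) auto
  then show ?thesis
  proof cases
    case 1
    then show ?thesis by (auto simp: taylor_test_def intro!: exI[of _ 1])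
  next
    case (2 k)
    have "norm (taylor_test N m n t) \<le> (pi * \<bar>of_int n\<bar>) ^ m * (1 / fact (Suc k))" for t
      using iexp_approx1[of "pi * of_int n * t" k] 2
      by (intro bound) (simp_all add: lessThan_Suc_atMost)
    then show ?thesis by blast
  next
    case (3 k)
    have "norm (taylor_test N m n t) \<le> (pi * \<bar>of_int n\<bar>) ^ m * (2 / fact k)" for t
      using iexp_approx2[of "pi * of_int n * t" k] 3
      by (intro bound) (simp_all add: lessThan_Suc_atMost mult.commute)
    then show ?thesis by blast
  qed
qed

text \<open>The subtracted polynomial has degree less than \<open>N\<close> in \<open>n\<close>, so \<open>N\<close> differences remove it.\<close>
lemma funpow_forward_diff_taylor_test:
  "(forward_diff ^^ N) (\<lambda>n. taylor_test N m n t) n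
     = fourier_mode n t * ((fourier_mode 1 t - 1) ^ N / (\<i> * of_real t) ^ m)"
proof -
  have "(\<lambda>n. taylor_test N m n t) = (\<lambda>n. 1 / (\<i> * of_real t) ^ m *
      (fourier_mode n t - (\<Sum>k<N. (1 / fact k * (\<i> * of_real (pi * t)) ^ k) * of_int n ^ k)))"
    by (simp add: taylor_test_def cis_conv_exp power_mult_distrib mult_ac)
  then have "(forward_diff ^^ N) (\<lambda>n. taylor_test N m n t) n = 1 / (\<i> * of_real t) ^ m *
      (fourier_mode n t * (fourier_mode 1 t - 1) ^ N
        - (\<Sum>k<N. (1 / fact k * (\<i> * of_real (pi * t)) ^ k) * (forward_diff ^^ N) (\<lambda>n. of_int n ^ k) n))"
    by (simp only: funpow_forward_diff_cmult funpow_forward_diff_diff funpow_forward_diff_sum funpow_forward_diff_fourier_mode)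
  also have "(\<Sum>k<N. (1 / fact k * (\<i> * of_real (pi * t)) ^ k) * (forward_diff ^^ N) (\<lambda>n. of_int n ^ k) n) = 0"
    by (intro sum.neutral) (simp add: funpow_forward_diff_monomial)
  finally show ?thesis by (simp add: mult.commute)
qed

lemma fourier_mode_periodic: "fourier_mode n (t + 2 * of_int j) = fourier_mode n t"
proof -
  have "fourier_mode n (t + 2 * of_int j) = fourier_mode n t * cis (2 * pi * of_int (n * j))"
    by (simp add: cis_mult algebra_simps)
  also have "cis (2 * pi * of_int (n * j)) = 1"
    by (rule cis_multiple_2pi) simp
  finally show ?thesis by simp
qed

text \<open>The Fourier coefficients of the periodization are those of \<open>g\<close> on the line.\<close>
lemma periodization_eq_0:
  assumes g: "integrable lborel g" "\<And>n. (\<integral>t. g t * fourier_mode n t \<partial>lborel) = 0"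
  shows "AE t in lborel_I. integrable (count_space UNIV) (\<lambda>j. g (t + 2 * of_int j))
           \<and> (\<integral>j. g (t + 2 * of_int j) \<partial>count_space UNIV) = 0"
proof -
  interpret C: sigma_finite_measure "count_space (UNIV :: int set)" by (rule sigma_finite_count_space_int)
  interpret I: finite_measure lborel_I
    by (rule finite_measureI) (simp add: space_restrict_space emeasure_restrict_space)
  interpret P: pair_sigma_finite lborel_I "count_space (UNIV :: int set)" ..
  let ?\<tau> = "\<lambda>(t, j). t + 2 * real_of_int j"
  let ?M = "lborel_I \<Otimes>\<^sub>M count_space UNIV"
  have unwrap: "integrable ?M (\<lambda>(t, j). F (t + 2 * of_int j)) \<and>
      (\<integral>t. (\<integral>j. F (t + 2 * of_int j) \<partial>count_space UNIV) \<partial>lborel_I) = (\<integral>t. F t \<partial>lborel)"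
    if F: "integrable lborel F" for F :: "real \<Rightarrow> complex"
  proof -
    have meas: "F \<in> borel_measurable borel" using F by simp
    have "integrable (distr ?M borel ?\<tau>) F"
      using F by (simp only: lborel_eq_distr_tile[symmetric])
    then have int: "integrable ?M (\<lambda>(t, j). F (t + 2 * of_int j))"
      by (subst (asm) integrable_distr_eq[OF measurable_tile_map meas]) (simp add: case_prod_unfold)
    have "(\<integral>t. F t \<partial>lborel) = (\<integral>t. F t \<partial>distr ?M borel ?\<tau>)"
      by (simp only: lborel_eq_distr_tile[symmetric])
    also have "\<dots> = (\<integral>p. F (?\<tau> p) \<partial>?M)"
      by (rule integral_distr[OF measurable_tile_map meas])
    also have "\<dots> = (\<integral>t. (\<integral>j. F (t + 2 * of_int j) \<partial>count_space UNIV) \<partial>lborel_I)"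
      using P.integral_fst[OF int] by (simp add: case_prod_unfold)
    finally show ?thesis using int by simp
  qed
  define G where "G t = (\<integral>j. g (t + 2 * of_int j) \<partial>count_space UNIV)" for t
  have ge: "integrable lborel (\<lambda>t. g t * fourier_mode n t)" for n
    by (rule integrable_mult_bounded[OF g(1), of _ 1]) auto
  have "AE t in lborel_I. G t = 0"
  proof (rule fourier_uniqueness)
    show "integrable lborel_I G"
      unfolding G_def using P.integrable_fst[OF conjunct1[OF unwrap[OF g(1)]]] by simp
    fix n
    have "(\<integral>t. G t * fourier_mode n t \<partial>lborel_I) = (\<integral>t. (\<integral>j. g (t + 2 * of_int j) * fourier_mode n (t + 2 * of_int j) \<partial>count_space UNIV) \<partial>lborel_I)"
      unfolding G_def fourier_mode_periodic integral_mult_left_zero ..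
    also have "\<dots> = 0"
      using conjunct2[OF unwrap[OF ge[of n]]] g(2) by simp
    finally show "(\<integral>t. G t * fourier_mode n t \<partial>lborel_I) = 0" .
  qed
  moreover have "AE t in lborel_I. integrable (count_space UNIV) (\<lambda>j. g (t + 2 * of_int j))"
    using P.AE_integrable_fst[OF conjunct1[OF unwrap[OF g(1)]]] by simp
  ultimately show ?thesis
    unfolding G_def by eventually_elim simp
qed

text \<open>The factor \<open>(exp (\<i> \<pi> t) - 1)^N\<close> is 2-periodic and nonzero off the even integers, so it cancels from the
  vanishing periodization, and the term \<open>j = 0\<close> is bounded by the others. Its factor
  \<open>1 / \<bar>t\<bar>^m\<close> dominates the factors \<open>1 / \<bar>t + 2 j\<bar>^m\<close> for \<open>j \<noteq> 0\<close>. The argument of \<open>transfer\<close> is \<open>\<bar>\<psi>\<bar>\<close>, for which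
  \<open>\<bar>\<psi> (1 / u)\<bar> / u\<^sup>2 = \<bar>\<phi> u\<bar>\<close>.\<close>
lemma annihilator_le_transfer:
  assumes \<phi>: "integrable lborel \<phi>" and m: "m = N \<or> Suc m = N"
    and ann: "\<And>n. (\<integral>t. \<phi> t * taylor_test N m n t \<partial>lborel) = 0"
  shows "AE t in lborel_I. ennreal (norm (\<phi> t)) \<le> transfer (\<lambda>s. ennreal (norm (\<phi> (1 / s) / of_real (s\<^sup>2)))) t"
proof -
  define g where "g t = \<phi> t * ((fourier_mode 1 t - 1) ^ N / (\<i> * of_real t) ^ m)" for t
  have int: "integrable lborel (\<lambda>t. \<phi> t * taylor_test N m n t)" for n
  proof -
    obtain B where "\<And>t. norm (taylor_test N m n t) \<le> B"
      using taylor_test_bounded[OF m] by blast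
    then show ?thesis by (intro integrable_mult_bounded[OF \<phi>]) auto
  qed
  have g_eq: "(forward_diff ^^ N) (\<lambda>n. \<phi> t * taylor_test N m n t) n = g t * fourier_mode n t" for n t
    by (simp only: funpow_forward_diff_cmult funpow_forward_diff_taylor_test g_def mult_ac)
  have g_int: "integrable lborel (\<lambda>t. g t * fourier_mode n t)"
    and g_0: "(\<integral>t. g t * fourier_mode n t \<partial>lborel) = 0" for n
    using integral_funpow_forward_diff[of lborel "\<lambda>n t. \<phi> t * taylor_test N m n t", OF int ann, of N n] unfolding g_eq by blast+
  have "integrable lborel g" using g_int[of 0] by simp
  then have "AE t in lborel_I. integrable (count_space UNIV) (\<lambda>j. g (t + 2 * of_int j))
      \<and> (\<integral>j. g (t + 2 * of_int j) \<partial>count_space UNIV) = 0"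
    by (rule periodization_eq_0[OF _ g_0])
  moreover have "AE t in lborel_I. t \<noteq> 0"
    by (subst AE_restrict_space_iff) (auto intro: eventually_mono[OF AE_lborel_singleton[of 0]])
  ultimately show ?thesis
    using AE_space
  proof eventually_elim
    case (elim t)
    then have t: "t \<in> {-1<..<1}" "t \<noteq> 0" by (auto simp: space_restrict_space)
    let ?g = "\<lambda>j::int. g (t + 2 * of_int j)"
    have int_g: "integrable (count_space UNIV) ?g" and sum_g: "(\<integral>j. ?g j \<partial>count_space UNIV) = 0"
      using elim(1) by auto
    have int_rest: "integrable (count_space UNIV) (\<lambda>j. indicator (- {0}) j *\<^sub>R ?g j)"
      by (intro integrable_mult_indicator int_g) simp
    have "0 = (\<integral>j. indicator {0} j *\<^sub>R ?g j + indicator (- {0}) j *\<^sub>R ?g j \<partial>count_space UNIV)"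
      unfolding sum_g[symmetric] by (intro Bochner_Integration.integral_cong) (auto split: split_indicator)
    also have "\<dots> = (\<integral>j. indicator {0} j *\<^sub>R ?g j \<partial>count_space UNIV) + (\<integral>j. indicator (- {0}) j *\<^sub>R ?g j \<partial>count_space UNIV)"
      by (intro Bochner_Integration.integral_add int_rest integrable_mult_indicator int_g) simp
    also have "(\<integral>j. indicator {0} j *\<^sub>R ?g j \<partial>count_space UNIV) = g t"
    proof -
      have "{j \<in> UNIV. indicator {0} j *\<^sub>R ?g j \<noteq> 0} = (if g t = 0 then {} else {0})"
        by (auto simp: indicator_def)
      then show ?thesis
        using lebesgue_integral_count_space_finite_support[of UNIV "\<lambda>j. indicator {0} j *\<^sub>R ?g j"]
        by (simp split: if_splits)
    qed
    finally have "g t = - (\<integral>j. indicator (- {0}) j *\<^sub>R ?g j \<partial>count_space UNIV)"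
      by (simp add: eq_neg_iff_add_eq_0)
    then have "ennreal (norm (g t)) \<le> (\<integral>\<^sup>+j. norm (indicator (- {0}) j *\<^sub>R ?g j) \<partial>count_space UNIV)"
      using integral_norm_bound_ennreal[OF int_rest] by simp
    also have "\<dots> = (\<integral>\<^sup>+j. norm (?g j) \<partial>count_space (- {0}))"
      by (subst nn_integral_count_space_indicator[of "- {0}"]) (auto intro!: nn_integral_cong split: split_indicator)
    finally have le: "ennreal (norm (g t)) \<le> (\<integral>\<^sup>+j. norm (?g j) \<partial>count_space (- {0}))" .
    define a where "a = norm (fourier_mode 1 t - 1) ^ N"
    have "fourier_mode 1 t \<noteq> 1"
      using cis_pi_inj[of t 0] t by auto
    then have a: "0 < a" unfolding a_def by simp
    have norm_g: "norm (g (t + 2 * of_int j)) = a * norm (\<phi> (t + 2 * of_int j)) / \<bar>t + 2 * of_int j\<bar> ^ m" for j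
      unfolding g_def fourier_mode_periodic a_def norm_mult norm_divide norm_power norm_of_real
      by simp
    define c where "c = \<bar>t\<bar> ^ m / a"
    have c: "0 < c" unfolding c_def using a t by simp
    have "ennreal (norm (\<phi> t)) = ennreal c * ennreal (norm (g t))"
      using norm_g[of 0] a t c by (simp add: c_def ennreal_mult[symmetric])
    also have "\<dots> \<le> (\<integral>\<^sup>+j. ennreal c * norm (?g j) \<partial>count_space (- {0}))"
      using le by (subst nn_integral_cmult) (auto intro: mult_left_mono)
    also have "\<dots> \<le> transfer (\<lambda>s. ennreal (norm (\<phi> (1 / s) / of_real (s\<^sup>2)))) t"
      unfolding transfer_def
    proof (intro nn_integral_mono)
      fix j :: int assume "j \<in> space (count_space (- {0}))"
      then have "j \<noteq> 0" by simp
      define u where "u = t + 2 * real_of_int j"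
      have u: "\<bar>u\<bar> > 1" using branch_point(1)[OF t(1) \<open>j \<noteq> 0\<close>] by (simp add: u_def)
      then have u0: "u \<noteq> 0" by auto
      have "\<bar>t\<bar> ^ m \<le> \<bar>u\<bar> ^ m" using u t by (intro power_mono) auto
      then have "\<bar>t\<bar> ^ m / \<bar>u\<bar> ^ m \<le> 1" using u0 by simp
      then have "\<bar>t\<bar> ^ m / \<bar>u\<bar> ^ m * norm (\<phi> u) \<le> 1 * norm (\<phi> u)" by (rule mult_right_mono) simp
      moreover have "c * norm (?g j) = \<bar>t\<bar> ^ m / \<bar>u\<bar> ^ m * norm (\<phi> u)"
        using a norm_g[of j] unfolding c_def u_def[symmetric] by simp
      moreover have "1 / u\<^sup>2 * norm (\<phi> (1 / (1 / u)) / of_real ((1 / u)\<^sup>2)) = norm (\<phi> u)"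
        using u0 by (simp add: norm_mult norm_divide norm_power power_divide)
      ultimately have "c * norm (?g j) \<le> 1 / u\<^sup>2 * norm (\<phi> (1 / (1 / u)) / of_real ((1 / u)\<^sup>2))" by simp
      then show "ennreal c * ennreal (norm (?g j)) \<le> ennreal (1 / (t + 2 * real_of_int j)\<^sup>2)
         * ennreal (norm (\<phi> (1 / (1 / (t + 2 * real_of_int j))) / of_real ((1 / (t + 2 * real_of_int j))\<^sup>2)))"
        unfolding u_def[symmetric] using c by (simp add: ennreal_mult[symmetric] ennreal_leI del: times_divide_eq_left times_divide_eq_right divide_divide_eq_right)
    qed
    finally show ?case .
  qed
qed

section \<open>The uniqueness theorem\<close>

lemma integral_reciprocal:
  fixes F :: "real \<Rightarrow> complex"
  assumes [measurable]: "F \<in> borel_measurable borel"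
  shows "integrable lborel (\<lambda>s. F (1 / s) / of_real (s\<^sup>2)) \<longleftrightarrow> integrable lborel F"
    and "(\<integral>s. F (1 / s) / of_real (s\<^sup>2) \<partial>lborel) = (\<integral>t. F t \<partial>lborel)"
proof -
  let ?D = "density lborel (\<lambda>s. ennreal (1 / s\<^sup>2)) :: real measure"
  have eq: "(\<lambda>s. F (1 / s) / of_real (s\<^sup>2)) = (\<lambda>s. (1 / s\<^sup>2) *\<^sub>R F (1 / s))"
    by (simp add: scaleR_conv_of_real fun_eq_iff)
  have "integrable lborel F \<longleftrightarrow> integrable (distr ?D borel (\<lambda>s. 1 / s)) F"
    by (simp only: lborel_eq_distr_reciprocal[symmetric])
  also have "\<dots> \<longleftrightarrow> integrable lborel (\<lambda>s. F (1 / s) / of_real (s\<^sup>2))"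
    unfolding eq by (subst integrable_distr_eq, simp, simp, subst integrable_density) auto
  finally show "integrable lborel (\<lambda>s. F (1 / s) / of_real (s\<^sup>2)) \<longleftrightarrow> integrable lborel F" ..
  have "(\<integral>t. F t \<partial>lborel) = (\<integral>t. F t \<partial>distr ?D borel (\<lambda>s. 1 / s))"
    by (simp only: lborel_eq_distr_reciprocal[symmetric])
  also have "\<dots> = (\<integral>s. F (1 / s) / of_real (s\<^sup>2) \<partial>lborel)"
    unfolding eq by (subst integral_distr, simp, simp, subst integral_density) auto
  finally show "(\<integral>s. F (1 / s) / of_real (s\<^sup>2) \<partial>lborel) = (\<integral>t. F t \<partial>lborel)" ..
qed

text \<open>The map \<open>\<phi> \<mapsto> \<psi>\<close> is an involution that exchanges the two families of conditions, so \<open>\<phi>\<close> and \<open>\<psi>\<close> bound each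
  other through \<open>transfer\<close> and their sum is subinvariant.\<close>
lemma annihilator_eq_0:
  fixes \<phi> :: "real \<Rightarrow> complex"
  assumes \<phi>: "integrable lborel \<phi>" and m: "m = N \<or> Suc m = N" and l: "l = M \<or> Suc l = M"
    and ann: "\<And>n. (\<integral>t. \<phi> t * taylor_test N m n t \<partial>lborel) = 0"
    and ann': "\<And>n. (\<integral>t. \<phi> t * taylor_test M l n (1 / t) \<partial>lborel) = 0"
  shows "AE t in lborel. \<phi> t = 0"
proof -
  have [measurable]: "\<phi> \<in> borel_measurable borel" using \<phi> by simp
  define \<psi> where "\<psi> s = \<phi> (1 / s) / of_real (s\<^sup>2)" for s
  have [measurable]: "\<psi> \<in> borel_measurable borel" unfolding \<psi>_def by measurable
  have \<psi>: "integrable lborel \<psi>"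
    using \<phi> integral_reciprocal(1)[of \<phi>] unfolding \<psi>_def by simp
  have "(\<integral>s. \<psi> s * taylor_test M l n s \<partial>lborel) = 0" for n
    using ann'[of n] integral_reciprocal(2)[of "\<lambda>t. \<phi> t * taylor_test M l n (1 / t)"]
    by (simp add: \<psi>_def)
  then have le_\<psi>: "AE t in lborel_I. ennreal (norm (\<psi> t)) \<le> transfer (\<lambda>s. ennreal (norm (\<phi> s))) t"
  proof -
    \<comment> \<open>The involution, at the level of absolute values.\<close>
    have inv: "norm (\<psi> (1 / s) / of_real (s\<^sup>2)) = norm (\<phi> s)" if "s \<noteq> 0" for s
      using that by (simp add: \<psi>_def norm_divide norm_power power_divide)
    have "AE t in lborel_I. ennreal (norm (\<psi> t)) \<le> transfer (\<lambda>s. ennreal (norm (\<psi> (1 / s) / of_real (s\<^sup>2)))) t"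
      by (rule annihilator_le_transfer[OF \<psi> l]) fact
    moreover have "transfer (\<lambda>s. ennreal (norm (\<psi> (1 / s) / of_real (s\<^sup>2)))) t = transfer (\<lambda>s. ennreal (norm (\<phi> s))) t"
      if "t \<in> {-1<..<1}" for t
      unfolding transfer_def
    proof (intro nn_integral_cong)
      fix j :: int assume "j \<in> space (count_space (- {0}))"
      then have nz: "1 / (t + 2 * real_of_int j) \<noteq> 0"
        using branch_point(1)[OF that, of j] by auto
      show "ennreal (1 / (t + 2 * real_of_int j)\<^sup>2) * ennreal (norm (\<psi> (1 / (1 / (t + 2 * real_of_int j))) / of_real ((1 / (t + 2 * real_of_int j))\<^sup>2)))
        = ennreal (1 / (t + 2 * real_of_int j)\<^sup>2) * ennreal (norm (\<phi> (1 / (t + 2 * real_of_int j))))"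
        by (simp only: inv[OF nz])
    qed
    ultimately show ?thesis
      by (auto simp: AE_restrict_space_iff elim!: eventually_mono)
  qed
  have le_\<phi>: "AE t in lborel_I. ennreal (norm (\<phi> t)) \<le> transfer (\<lambda>s. ennreal (norm (\<psi> s))) t"
    using annihilator_le_transfer[OF \<phi> m ann] unfolding \<psi>_def .
  define h where "h t = ennreal (norm (\<phi> t)) + ennreal (norm (\<psi> t))" for t
  have [measurable]: "h \<in> borel_measurable borel" unfolding h_def by measurable
  have "AE t in lborel_I. h t = 0"
  proof (rule subinvariant_density_eq_0)
    have "(\<integral>\<^sup>+t. h t \<partial>lborel_I) \<le> (\<integral>\<^sup>+t. h t \<partial>lborel)"
      by (subst nn_integral_restrict_space) (auto intro!: nn_integral_mono split: split_indicator)
    also have "\<dots> = (\<integral>\<^sup>+t. norm (\<phi> t) \<partial>lborel) + (\<integral>\<^sup>+t. norm (\<psi> t) \<partial>lborel)"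
      unfolding h_def by (intro nn_integral_add) auto
    also have "\<dots> < \<infinity>" using \<phi> \<psi> by (simp add: integrable_iff_bounded)
    finally show "(\<integral>\<^sup>+t. h t \<partial>lborel_I) < \<infinity>" .
    show "AE t in lborel_I. h t \<le> transfer h t"
      using le_\<phi> le_\<psi>
    proof eventually_elim
      case (elim t)
      then show ?case
        unfolding h_def[abs_def] transfer_add by (subst add.commute) (rule add_mono)
    qed
  qed measurable
  then have h0: "AE t in lborel. t \<in> {-1<..<1} \<longrightarrow> \<phi> t = 0 \<and> \<psi> t = 0"
    by (subst (asm) AE_restrict_space_iff) (auto simp: h_def elim!: eventually_mono)
  have "(\<integral>\<^sup>+t. ennreal (norm (\<phi> t)) * indicator (- {-1..1}) t \<partial>lborel)
     = (\<integral>\<^sup>+s. ennreal (1 / s\<^sup>2) * (ennreal (norm (\<phi> (1 / s))) * indicator (- {-1..1}) (1 / s)) \<partial>lborel)"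
    by (rule nn_integral_reciprocal[symmetric]) measurable
  also have "\<dots> = 0"
  proof (subst nn_integral_0_iff_AE, measurable, use h0 in eventually_elim)
    case (elim s)
    show "ennreal (1 / s\<^sup>2) * (ennreal (norm (\<phi> (1 / s))) * indicator (- {-1..1}) (1 / s)) = 0"
    proof (cases "s = 0 \<or> \<phi> (1 / s) = 0")
      case False
      then have "s \<notin> {-1<..<1}" using elim by (auto simp: \<psi>_def)
      then have "\<bar>1 / s\<bar> \<le> 1" using False by (auto simp: divide_le_eq)
      then have "1 / s \<in> {-1..1}" by (simp only: atLeastAtMost_iff) linarith
      then show ?thesis by simp
    qed auto
  qed
  finally have "AE t in lborel. ennreal (norm (\<phi> t)) * indicator (- {-1..1}) t = 0"
    by (subst (asm) nn_integral_0_iff_AE) auto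
  moreover have "AE t in lborel. t \<noteq> 1" "AE t in lborel. t \<noteq> (-1 :: real)"
    by (rule AE_lborel_singleton)+
  ultimately show ?thesis
    using h0
  proof eventually_elim
    case (elim t)
    show ?case
    proof (cases "t \<in> {-1..1}")
      case True
      then have "t \<in> {-1<..<1}" using elim(2,3) by auto
      with elim(4) show ?thesis by blast
    next
      case False
      with elim(1) show ?thesis by simp
    qed
  qed
qed

lemma lebesgue_integrable_borel_version:
  fixes \<phi> :: "real \<Rightarrow> complex"
  assumes "integrable lebesgue \<phi>"
  obtains \<phi>' where "integrable lborel \<phi>'" "AE t in lborel. \<phi> t = \<phi>' t"
proof -
  have "\<phi> \<in> borel_measurable (completion lborel)" using assms by simp
  then have "(\<lambda>t. Re (\<phi> t)) \<in> borel_measurable (completion lborel)" "(\<lambda>t. Im (\<phi> t)) \<in> borel_measurable (completion lborel)"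
    by auto
  then obtain u v where [measurable]: "u \<in> borel_measurable lborel" "v \<in> borel_measurable lborel"
    and uv: "AE t in lborel. Re (\<phi> t) = u t" "AE t in lborel. Im (\<phi> t) = v t"
    using completion_ex_borel_measurable_real by blast
  define \<phi>' where "\<phi>' t = Complex (u t) (v t)" for t
  have \<phi>'_alt: "\<phi>' = (\<lambda>t. of_real (u t) + \<i> * of_real (v t))"
    by (simp add: \<phi>'_def fun_eq_iff complex_eq_iff)
  have meas: "\<phi>' \<in> borel_measurable lborel" unfolding \<phi>'_alt by measurable
  have eq: "AE t in lborel. \<phi> t = \<phi>' t"
    using uv by eventually_elim (simp add: \<phi>'_def complex_eq_iff)
  have "integrable lebesgue \<phi>'"
    using assms AE_completion[OF eq] meas
    by (subst integrable_cong_AE[of _ _ \<phi>]) (auto intro: measurable_completion)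
  then have "integrable lborel \<phi>'" using meas by (simp add: integrable_completion)
  then show thesis using eq that by blast
qed

theorem theorem9p1:
  fixes \<phi> :: "real \<Rightarrow> complex"
    and N M :: nat
    and \<delta> :: "nat \<Rightarrow> nat"
  assumes "integrable lebesgue \<phi>"
    and "\<delta> 0 = 1"
    and "\<And>k. k \<ge> 1 \<Longrightarrow> \<delta> k \<in> {0, 1}"
    and "\<And>n :: int.
      (\<integral>t. \<phi> t * ((exp (\<i> * of_real (pi * of_int n * t))
                  - (\<Sum>k<N. 1 / fact k * (\<i> * of_real (pi * of_int n * t)) ^ k))
               / (\<i> * of_real t) powi (int N - 1 + int (\<delta> N))) \<partial>lebesgue) = 0"
    and "\<And>n :: int.
      (\<integral>t. \<phi> t * (exp (\<i> * of_real (pi * of_int n / t))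
                  - (\<Sum>k<M. 1 / fact k * (\<i> * of_real (pi * of_int n / t)) ^ k))
               * (of_real t / \<i>) powi (int M - 1 + int (\<delta> M)) \<partial>lebesgue) = 0"
  shows "AE t in lebesgue. \<phi> t = 0"
proof -
  \<comment> \<open>Since \<open>\<delta> 0 = 1\<close>, the integer exponents are nonnegative, hence ordinary powers.\<close>
  have expo: "\<exists>m. (m = K \<or> Suc m = K) \<and> int K - 1 + int (\<delta> K) = int m" for K
  proof (cases K)
    case 0
    then show ?thesis using assms(2) by auto
  next
    case (Suc k)
    then have "\<delta> K = 0 \<or> \<delta> K = 1" using assms(3)[of K] by auto
    then show ?thesis using Suc by auto
  qed
  obtain m where m: "m = N \<or> Suc m = N" "int N - 1 + int (\<delta> N) = int m" using expo by blast
  obtain l where l: "l = M \<or> Suc l = M" "int M - 1 + int (\<delta> M) = int l" using expo by blast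
  obtain \<phi>' where \<phi>': "integrable lborel \<phi>'" and eq: "AE t in lborel. \<phi> t = \<phi>' t"
    using lebesgue_integrable_borel_version[OF assms(1)] .
  have [measurable]: "\<phi>' \<in> borel_measurable borel" using \<phi>' by simp
  have transport: "(\<integral>t. \<phi>' t * u t \<partial>lborel) = (\<integral>t. \<phi> t * u t \<partial>lebesgue)"
    if [measurable]: "u \<in> borel_measurable borel" for u :: "real \<Rightarrow> complex"
  proof -
    have "(\<integral>t. \<phi>' t * u t \<partial>lborel) = (\<integral>t. \<phi>' t * u t \<partial>lebesgue)"
      by (rule integral_completion[symmetric]) simp
    also have "\<dots> = (\<integral>t. \<phi> t * u t \<partial>lebesgue)"
    proof (rule integral_cong_AE)
      show "AE t in lebesgue. \<phi>' t * u t = \<phi> t * u t"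
        using AE_completion[OF eq] by eventually_elim simp
      show "(\<lambda>t. \<phi>' t * u t) \<in> borel_measurable lebesgue"
        by (rule measurable_completion) simp
      show "(\<lambda>t. \<phi> t * u t) \<in> borel_measurable lebesgue"
        by (rule borel_measurable_times[OF borel_measurable_integrable[OF assms(1)] measurable_completion]) simp
    qed
    finally show ?thesis .
  qed
  have "(\<integral>t. \<phi>' t * taylor_test N m n t \<partial>lborel) = 0" for n
    using assms(4)[of n] by (subst transport) (simp_all add: taylor_test_def m(2))
  moreover have "(\<integral>t. \<phi>' t * taylor_test M l n (1 / t) \<partial>lborel) = 0" for n
  proof -
    have "1 / (\<i> * of_real (1 / t)) ^ l = (of_real t / \<i>) ^ l" for t :: real
    proof -
      have base: "1 / (\<i> * of_real (1 / t)) = of_real t / \<i>" by simp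
      show ?thesis by (simp only: power_one_over[symmetric] base)
    qed
    then have test: "taylor_test M l n (1 / t)
      = (exp (\<i> * of_real (pi * of_int n / t)) - (\<Sum>k<M. 1 / fact k * (\<i> * of_real (pi * of_int n / t)) ^ k))
          * (of_real t / \<i>) powi (int M - 1 + int (\<delta> M))" for t
      by (simp add: taylor_test_def l(2) divide_inverse)
    have "(\<integral>t. \<phi>' t * taylor_test M l n (1 / t) \<partial>lborel) = (\<integral>t. \<phi> t * taylor_test M l n (1 / t) \<partial>lebesgue)"
      by (rule transport) measurable
    also have "\<dots> = 0"
      using assms(5)[of n] by (simp only: test mult.assoc)
    finally show ?thesis .
  qed
  ultimately have "AE t in lborel. \<phi>' t = 0"
    by (rule annihilator_eq_0[OF \<phi>' m(1) l(1)])
  then have "AE t in lborel. \<phi> t = 0"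
    using eq by eventually_elim simp
  then show ?thesis by (rule AE_completion)
qed

end
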